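(* Let $\Theta=\mathbb{R}^n$ and write $\theta(i)$ for the $i$-th coordinate of $\theta$. Let $\theta^*\in\mathbb{R}$, $H_0=\{\theta\in\Theta:\theta(1)\le\theta^*\}$ and $H_1=\Theta\setminus H_0$. Assume: (1) for every $\theta\in\Theta$, $\mathbb{P}_\theta$ is absolutely continuous with respect to the Lebesgue measure $\lambda$ and $f_\theta(x):=\frac{d\mathbb{P}_\theta}{d\lambda}(x)>0$; (2) $f_\theta$ is in the exponential family: there exist $h=(h_1,\ldots,h_n):\mathcal{X}\to\mathbb{R}^n$ and functions $a,b$ such that $f_\theta(x)=b(x)\exp(\theta\cdot h(x)-a(\theta))$; (3) with $T=(h_2(X),\ldots,h_n(X))$, there exists a real-valued statistic $V=V(h(X))$ such that $V$ is increasing in $h_1(X)$ and $T$ and $V$ are independent whenever $\theta(1)=\theta^*$. Let $\bar\theta\in\Theta$ be such that $\bar\theta(1)=\theta^*$, let $\alpha+\beta\le1$, and let $c_0,c_1\in\mathbb{R}$ be such that $\mathbb{P}_{\bar\theta}(V\le c_0)=\beta$ and $\mathbb{P}_{\bar\theta}(V>c_1)=\alpha$. Then $\phi_{V,c_0,c_1}$ is a UMPU $(\alpha,\beta)$-level test.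
   Context: Setting: $X$ is the data, taking values in the sample space $\mathcal{X}$; $\mathbb{P}_\theta$ is the distribution of $X$ when the parameter is $\theta\in\Theta$; the null hypothesis is a subset $H_0\subset\Theta$ and $H_1=\Theta\setminus H_0$; $\alpha,\beta\in[0,1]$. An agnostic test is a function $\phi:\mathcal{X}\to\{0,\tfrac12,1\}$ ($0$ = accept $H_0$, $1$ = reject $H_0$, $\tfrac12$ = remain agnostic). Put $\alpha_\phi:=\sup_{\theta_0\in H_0}\mathbb{P}_{\theta_0}(\phi=1)$ and $\beta_\phi:=\sup_{\theta_1\in H_1}\mathbb{P}_{\theta_1}(\phi=0)$. The test has $(\alpha,\beta)$-level if $\alpha_\phi=\alpha$ and $\beta_\phi=\beta$; it has $(\alpha,\beta)$-size if $\alpha_\phi\le\alpha$ and $\beta_\phi\le\beta$. The power function is $\pi_\phi(\theta)=\mathbb{P}_\theta(\phi=0)$ for $\theta\in H_0$ and $\pi_\phi(\theta)=\mathbb{P}_\theta(\phi=1)$ for $\theta\in H_1$. Write $\phi_1\succeq\phi_2$ if $\pi_{\phi_1}(\theta)\ge\pi_{\phi_2}(\theta)$ for every $\theta\in\Theta$. $\phi$ is unbiased if $\inf_{\theta_0\in H_0}\mathbb{P}_{\theta_0}(\phi=0)\ge\beta_\phi$ and $\inf_{\theta_1\in H_1}\mathbb{P}_{\theta_1}(\phi=1)\ge\alpha_\phi$. An $(\alpha,\beta)$-level test $\phi^*$ is uniformly most powerful among unbiased tests (UMPU) if $\phi^*\succeq\phi$ for every unbiased $(\alpha,\beta)$-size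 test $\phi$. For a statistic $V$ and $c_0\le c_1$, $\phi_{V,c_0,c_1}(x)=0$ if $V\le c_0$, $=1$ if $V>c_1$, and $=\tfrac12$ otherwise. *)

theory Defs
  imports "HOL-Probability.Probability"
begin

section \<open>Agnostic tests\<close>

text \<open>
  The data live on a measurable space \<open>M\<close>, the model is a family \<open>P\<close> of probability
  measures on \<open>M\<close> indexed by \<open>\<Theta>\<close>, the null hypothesis is \<open>H0\<close>, the alternative is \<open>\<Theta> - H0\<close>.
  Decisions are real numbers: 0 = accept, 1 = reject, 1/2 = remain agnostic.
\<close>

definition agnostic_test :: "'x measure \<Rightarrow> ('x \<Rightarrow> real) \<Rightarrow> bool" where
  "agnostic_test M \<phi> \<longleftrightarrow> \<phi> \<in> M \<rightarrow>\<^sub>M count_space {0, 1/2, 1}"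

definition prob_decide :: "'x measure \<Rightarrow> ('x \<Rightarrow> real) \<Rightarrow> real \<Rightarrow> real" where
  "prob_decide Q \<phi> d = measure Q {x \<in> space Q. \<phi> x = d}"

text \<open>The suprema and infima below are those of the reals, hence meaningful only
  when \<open>H0\<close> and \<open>\<Theta> - H0\<close> are nonempty.\<close>

definition type1_error :: "('p \<Rightarrow> 'x measure) \<Rightarrow> 'p set \<Rightarrow> ('x \<Rightarrow> real) \<Rightarrow> real" where
  "type1_error P H0 \<phi> = (SUP \<theta>\<in>H0. prob_decide (P \<theta>) \<phi> 1)"

definition type2_error ::
  "('p \<Rightarrow> 'x measure) \<Rightarrow> 'p set \<Rightarrow> 'p set \<Rightarrow> ('x \<Rightarrow> real) \<Rightarrow> real" where
  "type2_error P \<Theta> H0 \<phi> = (SUP \<theta>\<in>\<Theta> - H0. prob_decide (P \<theta>) \<phi> 0)"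

text \<open>``Level'' asks for equality and ``size'' for an upper bound; the usual
  terminology is the other way round.\<close>

definition has_level ::
  "('p \<Rightarrow> 'x measure) \<Rightarrow> 'p set \<Rightarrow> 'p set \<Rightarrow> real \<Rightarrow> real \<Rightarrow> ('x \<Rightarrow> real) \<Rightarrow> bool" where
  "has_level P \<Theta> H0 \<alpha> \<beta> \<phi> \<longleftrightarrow> type1_error P H0 \<phi> = \<alpha> \<and> type2_error P \<Theta> H0 \<phi> = \<beta>"

definition has_size ::
  "('p \<Rightarrow> 'x measure) \<Rightarrow> 'p set \<Rightarrow> 'p set \<Rightarrow> real \<Rightarrow> real \<Rightarrow> ('x \<Rightarrow> real) \<Rightarrow> bool" where
  "has_size P \<Theta> H0 \<alpha> \<beta> \<phi> \<longleftrightarrow> type1_error P H0 \<phi> \<le> \<alpha> \<and> type2_error P \<Theta> H0 \<phi> \<le> \<beta>"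

definition power_fun :: "('p \<Rightarrow> 'x measure) \<Rightarrow> 'p set \<Rightarrow> ('x \<Rightarrow> real) \<Rightarrow> 'p \<Rightarrow> real" where
  "power_fun P H0 \<phi> \<theta> = (if \<theta> \<in> H0 then prob_decide (P \<theta>) \<phi> 0 else prob_decide (P \<theta>) \<phi> 1)"

definition at_least_as_powerful ::
  "('p \<Rightarrow> 'x measure) \<Rightarrow> 'p set \<Rightarrow> 'p set \<Rightarrow> ('x \<Rightarrow> real) \<Rightarrow> ('x \<Rightarrow> real) \<Rightarrow> bool" where
  "at_least_as_powerful P \<Theta> H0 \<phi> \<psi> \<longleftrightarrow> (\<forall>\<theta>\<in>\<Theta>. power_fun P H0 \<phi> \<theta> \<ge> power_fun P H0 \<psi> \<theta>)"

definition unbiased_test ::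
  "('p \<Rightarrow> 'x measure) \<Rightarrow> 'p set \<Rightarrow> 'p set \<Rightarrow> ('x \<Rightarrow> real) \<Rightarrow> bool" where
  "unbiased_test P \<Theta> H0 \<phi> \<longleftrightarrow>
     (INF \<theta>\<in>H0. prob_decide (P \<theta>) \<phi> 0) \<ge> type2_error P \<Theta> H0 \<phi> \<and>
     (INF \<theta>\<in>\<Theta> - H0. prob_decide (P \<theta>) \<phi> 1) \<ge> type1_error P H0 \<phi>"

definition UMPU_level_test ::
  "'x measure \<Rightarrow> ('p \<Rightarrow> 'x measure) \<Rightarrow> 'p set \<Rightarrow> 'p set \<Rightarrow> real \<Rightarrow> real \<Rightarrow> ('x \<Rightarrow> real) \<Rightarrow> bool" where
  "UMPU_level_test M P \<Theta> H0 \<alpha> \<beta> \<phi> \<longleftrightarrow>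
     agnostic_test M \<phi> \<and> has_level P \<Theta> H0 \<alpha> \<beta> \<phi> \<and>
     (\<forall>\<psi>. agnostic_test M \<psi> \<and> unbiased_test P \<Theta> H0 \<psi> \<and> has_size P \<Theta> H0 \<alpha> \<beta> \<psi> \<longrightarrow>
          at_least_as_powerful P \<Theta> H0 \<phi> \<psi>)"

definition threshold_test :: "('x \<Rightarrow> real) \<Rightarrow> real \<Rightarrow> real \<Rightarrow> 'x \<Rightarrow> real" where
  "threshold_test V c0 c1 x = (if V x \<le> c0 then 0 else if V x > c1 then 1 else 1/2)"

section \<open>Statistics\<close>

text \<open>Independence of two statistics with values in different spaces; the library's
  \<open>indep_var\<close> requires both value types to coincide.\<close>

definition indep_statistics ::
  "'x measure \<Rightarrow> 'u measure \<Rightarrow> ('x \<Rightarrow> 'u) \<Rightarrow> 'v measure \<Rightarrow> ('x \<Rightarrow> 'v) \<Rightarrow> bool" where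
  "indep_statistics Q MU U MV V \<longleftrightarrow>
     U \<in> Q \<rightarrow>\<^sub>M MU \<and> V \<in> Q \<rightarrow>\<^sub>M MV \<and>
     prob_space.indep_set Q {U -` A \<inter> space Q | A. A \<in> sets MU}
                            {V -` B \<inter> space Q | B. B \<in> sets MV}"

text \<open>All coordinates of \<open>u\<close> except the \<open>i\<close>-th, as an element of the product over \<open>- {i}\<close>;
  this also covers dimension one, where the product is trivial.\<close>

definition drop_coord :: "'n \<Rightarrow> real ^ 'n \<Rightarrow> 'n \<Rightarrow> real" where
  "drop_coord i u = (\<lambda>j\<in>- {i}. u $ j)"

text \<open>Monotonicity is only required on \<open>D\<close>, the range of the sufficient statistic: for
  \<open>V = h\<^sub>1 / sqrt (h\<^sub>2 - h\<^sub>1\<^sup>2)\<close> (the t statistic), say, there is no real-valued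
  monotone extension to the whole plane.\<close>

definition increasing_in_coord :: "'n \<Rightarrow> (real ^ 'n) set \<Rightarrow> (real ^ 'n \<Rightarrow> real) \<Rightarrow> bool" where
  "increasing_in_coord i D v \<longleftrightarrow>
     (\<forall>u\<in>D. \<forall>w\<in>D. (\<forall>j. j \<noteq> i \<longrightarrow> u $ j = w $ j) \<and> u $ i \<le> w $ i \<longrightarrow> v u \<le> v w)"

end

theory Submission
  imports Defs "HOL-Complex_Analysis.Cauchy_Integral_Formula"
begin

text \<open>
  On the boundary \<open>\<theta>(1) = \<theta>*\<close> the power functions of an unbiased test are constant, because they
  are continuous and the boundary borders on both hypotheses. The remaining coordinates of \<open>\<theta>\<close>
  range over a full Euclidean space, so \<open>T\<close> is boundedly complete there (a signed measure whose
  Laplace transform vanishes everywhere is zero), and the acceptance and rejection probabilities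
  of the test are constant even conditionally on \<open>T\<close>. By independence the same holds for tests
  based on \<open>V\<close>. Given \<open>T\<close>, the likelihood ratio between \<open>\<theta>\<close> and its projection to the boundary
  is monotone in \<open>h\<^sub>1\<close>, and the events \<open>V \<le> c\<close> and \<open>V > c\<close> are half-lines in \<open>h\<^sub>1\<close>, so the
  Neyman-Pearson argument applies fibrewise.
\<close>

section \<open>Vanishing Laplace transforms\<close>

text \<open>Finiteness of the real Laplace transform on both sides of 0 makes it entire. The
  exponential series is dominated by
  \<open>\<bar>G x\<bar> * exp (norm z * \<bar>X x\<bar>)\<close>, which two real exponentials with
  opposite signs bound, so sum and integral may be exchanged.\<close>

lemma integral_exp_power_series:
  fixes G X :: "'a \<Rightarrow> real" and z :: complex
  assumes X [measurable]: "X \<in> borel_measurable M"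
    and int: "\<And>t. integrable M (\<lambda>x. G x * exp (t * X x))"
  shows "integrable M (\<lambda>x. G x * exp (z * X x))"
    and "(\<lambda>n. complex_of_real (\<integral>x. G x * X x ^ n / fact n \<partial>M) * z ^ n) sums
           (\<integral>x. G x * exp (z * X x) \<partial>M)"
proof -
  have G [measurable]: "G \<in> borel_measurable M"
    using int[of 0] by (simp add: borel_measurable_integrable)
  define F where "F n x = complex_of_real (G x) * ((z * X x) ^ n / fact n)" for n x
  define E where "E x = \<bar>G x\<bar> * exp (norm z * \<bar>X x\<bar>)" for x
  have intE: "integrable M E"
  proof (rule Bochner_Integration.integrable_bound)
    show "integrable M (\<lambda>x. norm (G x * exp (norm z * X x)) + norm (G x * exp (- norm z * X x)))"
      by (intro Bochner_Integration.integrable_add integrable_norm int)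
    show "E \<in> borel_measurable M" unfolding E_def by measurable
    show "AE x in M. norm (E x) \<le> norm (norm (G x * exp (norm z * X x)) + norm (G x * exp (- norm z * X x)))"
    proof (rule AE_I2)
      fix x
      have "exp (norm z * \<bar>X x\<bar>) \<le> exp (norm z * X x) + exp (- norm z * X x)"
        by (cases "X x \<ge> 0") auto
      then have "\<bar>G x\<bar> * exp (norm z * \<bar>X x\<bar>) \<le> \<bar>G x\<bar> * (exp (norm z * X x) + exp (- norm z * X x))"
        by (rule mult_left_mono) simp
      then show "norm (E x) \<le> norm (norm (G x * exp (norm z * X x)) + norm (G x * exp (- norm z * X x)))"
        by (simp add: E_def abs_mult distrib_left)
    qed
  qed
  have normF: "norm (F n x) = \<bar>G x\<bar> * ((norm z * \<bar>X x\<bar>) ^ n / fact n)" for n x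
    by (simp add: F_def norm_mult norm_divide norm_power power_mult_distrib)
  have sumsN: "(\<lambda>n. norm (F n x)) sums E x" for x
    unfolding normF E_def using exp_converges[of "norm z * \<bar>X x\<bar>"]
    by (intro sums_mult) (simp add: divide_inverse mult.commute)
  have sumsF: "(\<lambda>n. F n x) sums (G x * exp (z * X x))" for x
    unfolding F_def using exp_converges[of "z * X x"]
    by (intro sums_mult) (simp add: scaleR_conv_of_real divide_inverse mult.commute)
  have measF [measurable]: "F n \<in> borel_measurable M" for n unfolding F_def by measurable
  have leE: "(\<Sum>i<n. norm (F i x)) \<le> E x" for n x
    using sumsN[of x] by (metis norm_ge_zero sum_le_suminf sums_iff finite_lessThan)
  have intF: "integrable M (F n)" for n
  proof (rule Bochner_Integration.integrable_bound[OF intE])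
    have "norm (F n x) \<le> norm (E x)" for x
      using leE[of x "Suc n"] sum_nonneg[of "{..<n}" "\<lambda>i. norm (F i x)"] by simp
    then show "AE x in M. norm (F n x) \<le> norm (E x)" by simp
  qed measurable
  have AEs: "AE x in M. summable (\<lambda>i. norm (F i x))"
    using sumsN by (auto simp: sums_iff)
  have summ: "summable (\<lambda>i. \<integral>x. norm (F i x) \<partial>M)"
  proof (rule summableI_nonneg_bounded)
    show "0 \<le> (\<integral>x. norm (F n x) \<partial>M)" for n by simp
    fix n
    have "(\<Sum>i<n. \<integral>x. norm (F i x) \<partial>M) = (\<integral>x. (\<Sum>i<n. norm (F i x)) \<partial>M)"
      by (rule Bochner_Integration.integral_sum[symmetric]) (intro integrable_norm intF)
    also have "\<dots> \<le> (\<integral>x. E x \<partial>M)"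
      by (intro integral_mono Bochner_Integration.integrable_sum integrable_norm intF intE leE)
    finally show "(\<Sum>i<n. \<integral>x. norm (F i x) \<partial>M) \<le> (\<integral>x. E x \<partial>M)" .
  qed
  have sumeq: "(\<Sum>i. F i x) = G x * exp (z * X x)" for x
    using sumsF[of x] by (simp add: sums_iff)
  show "integrable M (\<lambda>x. G x * exp (z * X x))"
    using integrable_suminf[OF intF AEs summ] by (simp add: sumeq)
  have eqc: "integral\<^sup>L M (F n) = complex_of_real (\<integral>x. G x * X x ^ n / fact n \<partial>M) * z ^ n" for n
  proof -
    have "F n = (\<lambda>x. complex_of_real (G x * X x ^ n / fact n) * z ^ n)"
      by (auto simp: F_def power_mult_distrib)
    then show ?thesis by (simp only: integral_mult_left_zero integral_complex_of_real)
  qed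
  show "(\<lambda>n. complex_of_real (\<integral>x. G x * X x ^ n / fact n \<partial>M) * z ^ n) sums
           (\<integral>x. G x * exp (z * X x) \<partial>M)"
    using sums_integral[OF intF AEs summ] unfolding eqc sumeq .
qed

text \<open>Identity theorem: the transform is a convergent power series in \<open>z\<close> that
  vanishes on the real line, hence all its coefficients are 0. The case needed later is imaginary
  \<open>z\<close>, where characteristic functions appear.\<close>

lemma integral_exp_zero_extends:
  fixes G X :: "'a \<Rightarrow> real" and z :: complex
  assumes X: "X \<in> borel_measurable M"
    and int: "\<And>t. integrable M (\<lambda>x. G x * exp (t * X x))"
    and zero: "\<And>t. (\<integral>x. G x * exp (t * X x) \<partial>M) = 0"
  shows "(\<integral>x. G x * exp (z * X x) \<partial>M) = 0"
proof -
  define c where "c n = complex_of_real (\<integral>x. G x * X x ^ n / fact n \<partial>M)" for n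
  define f where "f z = (\<integral>x. G x * exp (z * X x) \<partial>M)" for z :: complex
  have sums: "(\<lambda>n. c n * z ^ n) sums f z" for z
    unfolding c_def f_def by (rule integral_exp_power_series(2)[OF X int])
  have real0: "f (complex_of_real t) = 0" for t
  proof -
    have "f (complex_of_real t) = (\<integral>x. complex_of_real (G x * exp (t * X x)) \<partial>M)"
      unfolding f_def by (simp add: exp_of_real flip: of_real_mult)
    then show ?thesis by (simp only: integral_complex_of_real zero of_real_0)
  qed
  have c0: "c n = 0" for n
  proof (rule ccontr)
    assume n: "c n \<noteq> 0"
    have "c 0 = 0" using zero[of 0] by (simp add: c_def)
    with n have "n > 0" by (metis not_gr_zero)
    \<comment> \<open>A power series with a nonzero coefficient has an isolated zero at 0. The
      zero-free punctured disc contains the real point \<open>s\<close>, where \<open>f\<close> is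
      already known to vanish.\<close>
    obtain s where "s > 0" "\<And>z. z \<in> cball 0 s - {0} \<Longrightarrow> f z \<noteq> 0"
    proof (rule powser_0_nonzero[of 1 0 c f n])
      show "(\<lambda>n. c n * (z - 0) ^ n) sums f z" for z using sums[of z] by simp
      show "f 0 = 0" using real0[of 0] by simp
    qed (use n \<open>n > 0\<close> in auto)
    then have "f (complex_of_real s) \<noteq> 0" by auto
    with real0 show False by simp
  qed
  have "f z = 0" using sums[of z] by (simp add: c0 sums_iff)
  then show ?thesis by (simp add: f_def)
qed

text \<open>The positive and negative parts of \<open>G\<close>, taken as densities and pushed
  forward along \<open>X\<close>, have equal characteristic functions, so by Levy's uniqueness
  theorem they are the same law on the line.\<close>

lemma integral_exp_zero_imp_indicator_zero:
  fixes G X :: "'a \<Rightarrow> real"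
  assumes X [measurable]: "X \<in> borel_measurable M"
    and int: "\<And>t. integrable M (\<lambda>x. G x * exp (t * X x))"
    and zero: "\<And>t. (\<integral>x. G x * exp (t * X x) \<partial>M) = 0"
    and B [measurable]: "B \<in> sets borel"
  shows "(\<integral>x. G x * indicator B (X x) \<partial>M) = 0"
proof -
  have intG: "integrable M G" using int[of 0] by simp
  then have G [measurable]: "G \<in> borel_measurable M" by simp
  define p where "p x = max (G x) 0" for x
  define q where "q x = max (- G x) 0" for x
  have [measurable]: "p \<in> borel_measurable M" "q \<in> borel_measurable M"
    unfolding p_def q_def by measurable
  have pq: "G x = p x - q x" "p x \<ge> 0" "q x \<ge> 0" for x by (auto simp: p_def q_def)
  have intp: "integrable M p" and intq: "integrable M q"
    unfolding p_def q_def using intG by (auto intro!: integrable_max)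
  define m where "m = (\<integral>x. p x \<partial>M)"
  \<comment> \<open>The exponent 0 shows that both parts have the same total mass, so one constant
    \<open>m\<close> normalises both.\<close>
  have mq: "m = (\<integral>x. q x \<partial>M)"
    using zero[of 0] intp intq by (simp add: m_def pq(1))
  have "m \<ge> 0" using pq by (simp add: m_def)
  show ?thesis
  \<comment> \<open>Zero mass cannot be normalised; then \<open>G\<close> vanishes almost everywhere
    and the claim is immediate.\<close>
  proof (cases "m = 0")
    case True
    have "AE x in M. p x = 0" "AE x in M. q x = 0"
      using True mq integral_nonneg_eq_0_iff_AE[OF intp] integral_nonneg_eq_0_iff_AE[OF intq] pq
      by (auto simp: m_def)
    then have "AE x in M. G x * indicator B (X x) = 0"
      by eventually_elim (simp add: pq(1))
    then show ?thesis by (simp add: integral_eq_zero_AE)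
  next
    case False
    with \<open>m \<ge> 0\<close> have m: "m > 0" by simp
    define N where "N r = distr (density M (\<lambda>x. ennreal (r x / m))) borel X" for r :: "'a \<Rightarrow> real"
    have dist: "real_distribution (N r)"
      if r: "r \<in> borel_measurable M" "integrable M r" "\<And>x. r x \<ge> 0" "(\<integral>x. r x \<partial>M) = m" for r
    proof -
      have [measurable]: "r \<in> borel_measurable M" by fact
      have "prob_space (density M (\<lambda>x. ennreal (r x / m)))"
      proof
        have "emeasure (density M (\<lambda>x. ennreal (r x / m))) (space M) = (\<integral>\<^sup>+x. ennreal (r x / m) \<partial>M)"
          by (subst emeasure_density) (auto intro!: nn_integral_cong)
        also have "\<dots> = ennreal (\<integral>x. r x / m \<partial>M)"
          using r m by (intro nn_integral_eq_integral) auto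
        finally show "emeasure (density M (\<lambda>x. ennreal (r x / m))) (space (density M (\<lambda>x. ennreal (r x / m)))) = 1"
          using r m by simp
      qed
      then interpret D: prob_space "density M (\<lambda>x. ennreal (r x / m))" .
      show ?thesis unfolding N_def by (intro D.real_distribution_distr) simp
    qed
    have Nint: "(\<integral>y. g y \<partial>N r) = (\<integral>x. (r x / m) *\<^sub>R g (X x) \<partial>M)"
      if [measurable]: "r \<in> borel_measurable M" "g \<in> borel_measurable borel" and "\<And>x. r x \<ge> 0"
      for r and g :: "real \<Rightarrow> 'c::{banach,second_countable_topology}"
      unfolding N_def using that m
      by (subst integral_distr) (auto intro!: integral_density)
    have "char (N p) = char (N q)"
    proof
      fix u :: real
      define e where "e x = exp (\<i> * u * X x)" for x
      have [measurable]: "e \<in> borel_measurable M" unfolding e_def by measurable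
      have ne: "norm (e x) = 1" for x by (simp add: e_def)
      have ie: "integrable M (\<lambda>x. (r x / m) *\<^sub>R e x)" if "integrable M r" for r
      proof (rule Bochner_Integration.integrable_bound)
        show "integrable M (\<lambda>x. r x / m)" using that by simp
        have "r \<in> borel_measurable M" using that by simp
        then show "(\<lambda>x. (r x / m) *\<^sub>R e x) \<in> borel_measurable M" by measurable
      qed (simp add: ne)
      have ch: "char (N r) u = (\<integral>x. (r x / m) *\<^sub>R e x \<partial>M)"
        if "r \<in> borel_measurable M" "\<And>x. r x \<ge> 0" for r
        unfolding char_def using that
        by (subst Nint) (auto simp: e_def mult.assoc)
      have "char (N p) u - char (N q) u = (\<integral>x. (p x / m) *\<^sub>R e x - (q x / m) *\<^sub>R e x \<partial>M)"
        using pq intp intq by (simp add: ch ie)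
      also have "\<dots> = (\<integral>x. (G x * e x) / m \<partial>M)"
        by (intro Bochner_Integration.integral_cong) (auto simp: pq(1) scaleR_conv_of_real diff_divide_distrib left_diff_distrib)
      \<comment> \<open>This evaluates the extended transform at the imaginary point
        \<open>\<i> * u\<close>.\<close>
      also have "\<dots> = 0"
        using integral_exp_zero_extends[OF X int zero, of "\<i> * u"] by (simp add: e_def)
      finally show "char (N p) u = char (N q) u" by simp
    qed
    then have "N p = N q"
      using pq intp intq mq by (intro Levy_uniqueness dist) (auto simp: m_def)
    then have "(\<integral>y. (indicator B y :: real) \<partial>N p) = (\<integral>y. indicator B y \<partial>N q)" by simp
    moreover have "(\<integral>y. (indicator B y :: real) \<partial>N r) = (\<integral>x. r x * indicator B (X x) \<partial>M) / m"
      if "r \<in> borel_measurable M" "\<And>x. r x \<ge> 0" for r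
      using that by (subst Nint) auto
    ultimately have "(\<integral>x. p x * indicator B (X x) \<partial>M) = (\<integral>x. q x * indicator B (X x) \<partial>M)"
      using pq m by simp
    moreover have "integrable M (\<lambda>x. r x * indicator B (X x))" if "integrable M r" for r :: "'a \<Rightarrow> real"
    proof (rule Bochner_Integration.integrable_bound[OF that])
      have "r \<in> borel_measurable M" using that by simp
      then show "(\<lambda>x. r x * indicator B (X x)) \<in> borel_measurable M" by measurable
    qed (auto simp: indicator_def)
    ultimately show ?thesis
      using intp intq by (simp add: pq(1) left_diff_distrib)
  qed
qed

text \<open>The coordinates are converted from exponentials to indicators one at a time. The weight
  \<open>G\<close> stays general in the induction, because it has to absorb the exponential of the
  new coordinate first and the indicators of the old ones afterwards.\<close>

lemma integral_exp_zero_imp_rectangle_zero: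
  fixes X :: "'i \<Rightarrow> 'a \<Rightarrow> real" and G :: "'a \<Rightarrow> real"
  assumes "finite J"
    and "\<And>j. j \<in> J \<Longrightarrow> X j \<in> borel_measurable M"
    and "\<And>t. integrable M (\<lambda>x. G x * exp (\<Sum>j\<in>J. t j * X j x))"
    and "\<And>t. (\<integral>x. G x * exp (\<Sum>j\<in>J. t j * X j x) \<partial>M) = 0"
    and "\<And>j. j \<in> J \<Longrightarrow> B j \<in> sets borel"
  shows "(\<integral>x. G x * (\<Prod>j\<in>J. indicator (B j) (X j x)) \<partial>M) = 0"
  using assms
proof (induction J arbitrary: G rule: finite_induct)
  case empty
  then show ?case by simp
next
  case (insert k J)
  note meas = insert.prems(1) and int = insert.prems(2) and zero = insert.prems(3)
    and B = insert.prems(4)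
  have [measurable]: "X k \<in> borel_measurable M" using meas by simp
  have split: "(\<Sum>j\<in>insert k J. (t(k := r)) j * X j x) = r * X k x + (\<Sum>j\<in>J. t j * X j x)" for t r x
  proof -
    have "(\<Sum>j\<in>J. (t(k := r)) j * X j x) = (\<Sum>j\<in>J. t j * X j x)"
      using insert.hyps by (intro sum.cong) auto
    then show ?thesis using insert.hyps by (simp del: fun_upd_apply add: fun_upd_same)
  qed
  define I where "I x = (\<Prod>j\<in>J. indicator (B j) (X j x) :: real)" for x
  have I [measurable]: "I \<in> borel_measurable M"
    unfolding I_def
  proof (rule borel_measurable_prod)
    fix j assume "j \<in> J"
    then have [measurable]: "X j \<in> borel_measurable M" "B j \<in> sets borel" using meas B by auto
    show "(\<lambda>x. indicator (B j) (X j x) :: real) \<in> borel_measurable M" by measurable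
  qed
  have I01: "0 \<le> I x" "I x \<le> 1" for x
    unfolding I_def by (auto intro!: prod_nonneg prod_le_1)
  \<comment> \<open>With the \<open>k\<close>-th exponent frozen at \<open>r\<close>, the induction
    hypothesis for the weight \<open>G x * exp (r * X k x)\<close> replaces all other exponentials
    by indicators. As a function of \<open>r\<close>, the result is a one-dimensional Laplace
    transform with weight \<open>G x * I x\<close>.\<close>
  have *: "(\<integral>x. (G x * exp (r * X k x)) * I x \<partial>M) = 0" for r
    unfolding I_def
  proof (rule insert.IH)
    show "integrable M (\<lambda>x. G x * exp (r * X k x) * exp (\<Sum>j\<in>J. t j * X j x))" for t
      using int[of "t(k := r)"] unfolding split by (simp add: exp_add mult.assoc)
    show "(\<integral>x. G x * exp (r * X k x) * exp (\<Sum>j\<in>J. t j * X j x) \<partial>M) = 0" for t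
      using zero[of "t(k := r)"] unfolding split by (simp add: exp_add mult.assoc)
  qed (use meas B in auto)
  have intk: "integrable M (\<lambda>x. G x * exp (r * X k x))" for r
    using int[of "(\<lambda>_. 0)(k := r)"] unfolding split by simp
  have "(\<integral>x. (G x * I x) * indicator (B k) (X k x) \<partial>M) = 0"
  proof (rule integral_exp_zero_imp_indicator_zero)
    fix r
    show "integrable M (\<lambda>x. G x * I x * exp (r * X k x))"
    proof (rule Bochner_Integration.integrable_bound[OF intk[of r]])
      have [measurable]: "G \<in> borel_measurable M" using intk[of 0] by simp
      show "(\<lambda>x. G x * I x * exp (r * X k x)) \<in> borel_measurable M" by measurable
      show "AE x in M. norm (G x * I x * exp (r * X k x)) \<le> norm (G x * exp (r * X k x))"
        using I01 by (auto simp: abs_mult mult_left_le intro!: mult_right_mono)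
    qed
    show "(\<integral>x. G x * I x * exp (r * X k x) \<partial>M) = 0"
      using *[of r] by (simp add: mult_ac)
  qed (use B in auto)
  then show ?case using insert.hyps by (simp add: I_def mult_ac)
qed

lemma emeasure_distr_density_real:
  fixes p :: "'a \<Rightarrow> real"
  assumes p: "integrable M p" "\<And>x. p x \<ge> 0"
    and T [measurable]: "T \<in> M \<rightarrow>\<^sub>M N" and C [measurable]: "C \<in> sets N"
  shows "emeasure (distr (density M (\<lambda>x. ennreal (p x))) N T) C =
           ennreal (\<integral>x. p x * indicator C (T x) \<partial>M)"
proof -
  have [measurable]: "p \<in> borel_measurable M" using p by simp
  have "emeasure (distr (density M (\<lambda>x. ennreal (p x))) N T) C =
          (\<integral>\<^sup>+x. ennreal (p x) * indicator (T -` C \<inter> space M) x \<partial>M)"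
    by (subst emeasure_distr) (auto simp: emeasure_density)
  also have "\<dots> = (\<integral>\<^sup>+x. ennreal (p x * indicator C (T x)) \<partial>M)"
    by (intro nn_integral_cong) (auto simp: indicator_def)
  also have "\<dots> = ennreal (\<integral>x. p x * indicator C (T x) \<partial>M)"
  proof (rule nn_integral_eq_integral)
    show "integrable M (\<lambda>x. p x * indicator C (T x))"
      by (rule Bochner_Integration.integrable_bound[OF p(1)]) (auto simp: indicator_def)
  qed (use p in auto)
  finally show ?thesis .
qed

text \<open>Rectangles are stable under intersection and generate the product sigma-algebra, so two
  finite measures that agree on them are equal. These are again the images of the positive and
  negative parts of \<open>G\<close>.\<close>

lemma integral_exp_zero_imp_vimage_zero:
  fixes X :: "'i \<Rightarrow> 'a \<Rightarrow> real" and G :: "'a \<Rightarrow> real"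
  assumes J: "finite J"
    and X: "\<And>j. j \<in> J \<Longrightarrow> X j \<in> borel_measurable M"
    and int: "\<And>t. integrable M (\<lambda>x. G x * exp (\<Sum>j\<in>J. t j * X j x))"
    and zero: "\<And>t. (\<integral>x. G x * exp (\<Sum>j\<in>J. t j * X j x) \<partial>M) = 0"
    and C: "C \<in> sets (\<Pi>\<^sub>M j\<in>J. borel)"
  shows "(\<integral>x. G x * indicator C (\<lambda>j\<in>J. X j x) \<partial>M) = 0"
proof -
  define T where "T x = (\<lambda>j\<in>J. X j x)" for x
  have T [measurable]: "T \<in> M \<rightarrow>\<^sub>M (\<Pi>\<^sub>M j\<in>J. borel)"
    unfolding T_def using X by (intro measurable_restrict)
  define p where "p x = max (G x) 0" for x
  define q where "q x = max (- G x) 0" for x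
  have intG: "integrable M G" using int[of "\<lambda>_. 0"] by simp
  have pq: "G x = p x - q x" "p x \<ge> 0" "q x \<ge> 0" for x by (auto simp: p_def q_def)
  have intp: "integrable M p" and intq: "integrable M q"
    unfolding p_def q_def using intG by (auto intro!: integrable_max)
  have bound: "integrable M (\<lambda>x. r x * indicator C (T x))"
    if "integrable M r" "C \<in> sets (\<Pi>\<^sub>M j\<in>J. borel)" for r :: "'a \<Rightarrow> real" and C
  proof (rule Bochner_Integration.integrable_bound[OF that(1)])
    have "r \<in> borel_measurable M" using that(1) by simp
    with that(2) show "(\<lambda>x. r x * indicator C (T x)) \<in> borel_measurable M" by measurable
  qed (auto simp: indicator_def)
  have diff: "(\<integral>x. G x * indicator C (T x) \<partial>M) =
      (\<integral>x. p x * indicator C (T x) \<partial>M) - (\<integral>x. q x * indicator C (T x) \<partial>M)"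
    if "C \<in> sets (\<Pi>\<^sub>M j\<in>J. borel)" for C
    using bound[OF intp that] bound[OF intq that] by (simp add: pq(1) left_diff_distrib)
  have "distr (density M (\<lambda>x. ennreal (p x))) (\<Pi>\<^sub>M j\<in>J. borel) T =
        distr (density M (\<lambda>x. ennreal (q x))) (\<Pi>\<^sub>M j\<in>J. borel) T" (is "?P = ?Q")
  proof (rule measure_eqI_PiM_finite[where I = J and M = "\<lambda>_. borel" and A = "\<lambda>_. space (\<Pi>\<^sub>M j\<in>J. borel)"])
    fix A assume A: "\<And>i. i \<in> J \<Longrightarrow> A i \<in> sets (borel :: real measure)"
    then have AJ: "Pi\<^sub>E J A \<in> sets (\<Pi>\<^sub>M j\<in>J. borel)"
      using J by (intro sets_PiM_I_finite) auto
    have "indicator (Pi\<^sub>E J A) (T x) = (\<Prod>j\<in>J. indicator (A j) (X j x) :: real)" for x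
    proof (cases "\<forall>j\<in>J. X j x \<in> A j")
      case False
      then have "(\<Prod>j\<in>J. indicator (A j) (X j x) :: real) = 0"
        using J by (auto simp: prod_zero_iff indicator_def)
      with False show ?thesis by (auto simp: T_def indicator_def PiE_iff)
    qed (auto simp: T_def)
    then have "(\<integral>x. G x * indicator (Pi\<^sub>E J A) (T x) \<partial>M) = 0"
      using integral_exp_zero_imp_rectangle_zero[OF J X int zero A] by simp
    with diff[OF AJ] show "emeasure ?P (Pi\<^sub>E J A) = emeasure ?Q (Pi\<^sub>E J A)"
      using AJ pq intp intq by (simp add: emeasure_distr_density_real)
  next
    \<comment> \<open>The measures are finite, so the constant sequence at the whole space serves as
      the exhaustion.\<close>
    show "range (\<lambda>_. space (\<Pi>\<^sub>M j\<in>J. borel)) \<subseteq> prod_algebra J (\<lambda>_. borel :: real measure)"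
      using J by (auto simp: space_PiM intro!: prod_algebraI_finite)
    show "emeasure ?P (space (\<Pi>\<^sub>M j\<in>J. borel)) \<noteq> \<infinity>" 
      using pq intp by (simp add: emeasure_distr_density_real)
  qed (use J in auto)
  then have "emeasure ?P C = emeasure ?Q C" by simp
  then have "(\<integral>x. p x * indicator C (T x) \<partial>M) = (\<integral>x. q x * indicator C (T x) \<partial>M)"
    using C pq intp intq by (simp add: emeasure_distr_density_real Bochner_Integration.integral_nonneg)
  with diff[OF C] show ?thesis by (simp add: T_def)
qed

section \<open>A fibrewise Neyman-Pearson lemma\<close>

text \<open>The image \<open>T ` A\<close> itself need not be a Borel set. Inner regularity of the law of \<open>(x, T x)\<close>
  exhausts the graph of \<open>T\<close> over \<open>A\<close> by compact sets, whose projections are compact.\<close>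

lemma image_contains_Borel_carrier:
  fixes Q :: "'a :: {second_countable_topology, complete_space} measure"
    and T :: "'a \<Rightarrow> 'b :: {second_countable_topology, complete_space}"
  assumes "finite_measure Q"
    and sets_Q: "sets Q = sets (restrict_space borel S)" and S: "S \<in> sets borel"
    and T [measurable]: "T \<in> borel_measurable Q" and A: "A \<in> sets Q"
  shows "\<exists>C\<in>sets borel. C \<subseteq> T ` A \<and> (AE x in Q. x \<in> A \<longrightarrow> T x \<in> C)"
proof -
  interpret finite_measure Q by fact
  define N where "N = distr Q borel (\<lambda>x. (x, T x))"
  have sp: "space Q = S" using sets_eq_imp_space_eq[OF sets_Q] by (simp add: space_restrict_space)
  have id [measurable]: "(\<lambda>x. x) \<in> borel_measurable Q"
    by (subst measurable_cong_sets[OF sets_Q refl]) (rule measurable_restrict_space1, simp)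
  have pair [measurable]: "(\<lambda>x. (x, T x)) \<in> borel_measurable Q"
    by (intro borel_measurable_Pair) auto
  \<comment> \<open>\<open>T\<close> is measurable only on \<open>S\<close>. Extending it by a
    constant makes its graph over \<open>A\<close> a Borel subset of the full product; the condition
    that a distance is 0 expresses equality in a form whose measurability is routine.\<close>
  define T' where "T' x = (if x \<in> S then T x else undefined)" for x
  have "T \<in> borel_measurable (restrict_space borel S)"
    using T by (subst (asm) measurable_cong_sets[OF sets_Q refl])
  then have T' [measurable]: "T' \<in> borel_measurable borel"
    unfolding T'_def using S by (subst (asm) measurable_restrict_space_iff) auto
  define \<Gamma> where "\<Gamma> = {p. fst p \<in> A \<and> dist (snd p) (T' (fst p)) = 0}"
  have A': "A \<in> sets borel" "A \<subseteq> S" 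
    using A sets_Q S by (auto simp: sets_restrict_space)
  have \<Gamma> [measurable]: "\<Gamma> \<in> sets borel"
  proof -
    have [measurable]: "A \<in> sets borel" by fact
    have "{p \<in> space (borel \<Otimes>\<^sub>M borel). fst p \<in> A \<and> dist (snd p) (T' (fst p)) = 0}
             \<in> sets (borel \<Otimes>\<^sub>M borel)" by measurable
    then show ?thesis unfolding \<Gamma>_def borel_prod by simp
  qed
  have "emeasure N (space N) \<noteq> \<infinity>"
    by (simp add: N_def emeasure_distr)
  then have inner: "emeasure N \<Gamma> = (SUP K\<in>{K. K \<subseteq> \<Gamma> \<and> compact K}. emeasure N K)"
    using \<Gamma> by (intro inner_regular) (auto simp: N_def)
  have "{K. K \<subseteq> \<Gamma> \<and> compact K} \<noteq> {}" by auto
  \<comment> \<open>Countably many compact sets already attain the supremum, so the union of their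
    projections is Borel.\<close>
  from ennreal_SUP_countable_SUP[OF this, of "emeasure N"] inner
  obtain g where g: "range g \<subseteq> emeasure N ` {K. K \<subseteq> \<Gamma> \<and> compact K}"
    "emeasure N \<Gamma> = (SUP n::nat. g n)" by auto
  then have "\<forall>n. \<exists>K. K \<subseteq> \<Gamma> \<and> compact K \<and> g n = emeasure N K" by auto
  then obtain K where K: "\<And>n. K n \<subseteq> \<Gamma>" "\<And>n. compact (K n)" "\<And>n. g n = emeasure N (K n)"
    by metis
  define C where "C = (\<Union>n. snd ` K n)"
  have C [measurable]: "C \<in> sets borel"
    unfolding C_def using K(2)
    by (intro sets.countable_UN) (auto intro!: borel_compact compact_continuous_image continuous_intros)
  have "C \<subseteq> T ` A"
    using K(1) A'(2) by (fastforce simp: C_def \<Gamma>_def T'_def)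
  have "(\<lambda>x. (x, T x)) -` \<Gamma> \<inter> space Q = A"
    using A' sp by (auto simp: \<Gamma>_def T'_def)
  then have "emeasure Q A = emeasure N \<Gamma>"
    by (simp add: N_def emeasure_distr)
  also have "\<dots> \<le> emeasure Q (A \<inter> (T -` C \<inter> space Q))"
    unfolding g(2)
  proof (rule SUP_least)
    fix n
    have [measurable]: "K n \<in> sets borel" using K(2) by (rule borel_compact)
    have "g n = emeasure Q ((\<lambda>x. (x, T x)) -` K n \<inter> space Q)"
      unfolding K(3) N_def by (rule emeasure_distr) auto
    also have "\<dots> \<le> emeasure Q (A \<inter> (T -` C \<inter> space Q))"
    proof (rule emeasure_mono)
      show "(\<lambda>x. (x, T x)) -` K n \<inter> space Q \<subseteq> A \<inter> (T -` C \<inter> space Q)"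
        using K(1)[of n] by (force simp: \<Gamma>_def C_def)
    qed (use A in measurable)
    finally show "g n \<le> emeasure Q (A \<inter> (T -` C \<inter> space Q))" .
  qed
  finally have ge: "emeasure Q A \<le> emeasure Q (A \<inter> (T -` C \<inter> space Q))" .
  \<comment> \<open>Since \<open>Q\<close> is finite, equal masses of \<open>A\<close> and of its
    part over \<open>C\<close> leave only a null set.\<close>
  have "emeasure Q (A - (A \<inter> (T -` C \<inter> space Q))) = emeasure Q A - emeasure Q (A \<inter> (T -` C \<inter> space Q))"
    using A by (intro emeasure_Diff) auto
  also have "\<dots> = 0" using ge by (simp add: diff_eq_0_ennreal less_top[symmetric])
  finally have "A - (A \<inter> (T -` C \<inter> space Q)) \<in> null_sets Q" using A by auto
  then have "AE x in Q. x \<notin> A - (A \<inter> (T -` C \<inter> space Q))" by (rule AE_not_in)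
  then have "AE x in Q. x \<in> A \<longrightarrow> T x \<in> C" by eventually_elim auto
  with C \<open>C \<subseteq> T ` A\<close> show ?thesis by blast
qed

text \<open>Write \<open>w x\<close> as the length of \<open>{0..<w x}\<close> and apply Tonelli. A
  comparison of integrals with weight \<open>w\<close> is thereby reduced to its superlevel
  sets.\<close>

lemma nn_integral_layer_cake:
  fixes w :: "'a \<Rightarrow> real" and F :: "'a \<Rightarrow> ennreal"
  assumes "sigma_finite_measure Q"
    and [measurable]: "w \<in> borel_measurable Q" "F \<in> borel_measurable Q"
    and w: "\<And>x. 0 \<le> w x"
  shows "(\<integral>\<^sup>+x. F x * ennreal (w x) \<partial>Q) =
    (\<integral>\<^sup>+t. indicator {0..} t * (\<integral>\<^sup>+x. F x * indicator {x. t < w x} x \<partial>Q) \<partial>lborel)"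
proof -
  interpret Q: sigma_finite_measure Q by fact
  interpret pair_sigma_finite Q lborel ..
  have "(\<integral>\<^sup>+x. F x * ennreal (w x) \<partial>Q) =
      (\<integral>\<^sup>+x. (\<integral>\<^sup>+t. (if 0 \<le> t \<and> t < w x then F x else 0) \<partial>lborel) \<partial>Q)"
  proof (rule nn_integral_cong)
    fix x assume "x \<in> space Q"
    have "F x * ennreal (w x) = (\<integral>\<^sup>+t. F x * indicator {0..<w x} t \<partial>lborel)"
      using w by (subst nn_integral_cmult) auto
    also have "\<dots> = (\<integral>\<^sup>+t. (if 0 \<le> t \<and> t < w x then F x else 0) \<partial>lborel)"
      by (intro nn_integral_cong) (auto simp: indicator_def)
    finally show "F x * ennreal (w x) = \<dots>" .
  qed
  also have "\<dots> = (\<integral>\<^sup>+t. (\<integral>\<^sup>+x. (if 0 \<le> t \<and> t < w x then F x else 0) \<partial>Q) \<partial>lborel)"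
    by (rule Fubini'[symmetric]) measurable
  also have "\<dots> = (\<integral>\<^sup>+t. indicator {0..} t * (\<integral>\<^sup>+x. F x * indicator {x. t < w x} x \<partial>Q) \<partial>lborel)"
    by (intro nn_integral_cong) (auto simp: indicator_def intro!: nn_integral_cong)
  finally show ?thesis .
qed

text \<open>Conditional form of the Neyman-Pearson lemma, \<open>dom\<close> saying that
  \<open>E(\<psi> | T) \<le> P(U | T)\<close>. It is proved separately on each layer \<open>{r < w}\<close>: fibres of \<open>T\<close> that
  meet \<open>{r < w} - U\<close> satisfy \<open>U \<subseteq> {r < w}\<close>, all others \<open>{r < w} \<subseteq> U\<close>. In this way no
  measurable threshold as a function of \<open>T\<close> and no conditional distribution is needed.\<close>

lemma nn_integral_le_if_fibrewise_upper_set: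
  fixes Q :: "'a :: {second_countable_topology, complete_space} measure"
    and T :: "'a \<Rightarrow> 'b :: {second_countable_topology, complete_space}"
    and w \<psi> :: "'a \<Rightarrow> real"
  assumes fin: "finite_measure Q"
    and sets_Q: "sets Q = sets (restrict_space borel S)" and S: "S \<in> sets borel"
    and T [measurable]: "T \<in> borel_measurable Q"
    and U [measurable]: "U \<in> sets Q"
    and w [measurable]: "w \<in> borel_measurable Q" and w0: "\<And>x. 0 \<le> w x"
    and \<psi> [measurable]: "\<psi> \<in> borel_measurable Q" and \<psi>1: "\<And>x. \<psi> x \<le> 1"
    and dom: "\<And>C. C \<in> sets borel \<Longrightarrow>
      (\<integral>\<^sup>+x. ennreal (\<psi> x) * indicator C (T x) \<partial>Q) \<le> (\<integral>\<^sup>+x. indicator U x * indicator C (T x) \<partial>Q)"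
    and mono: "\<And>x y. \<lbrakk>x \<in> space Q - U; y \<in> U; T x = T y\<rbrakk> \<Longrightarrow> w x \<le> w y"
  shows "(\<integral>\<^sup>+x. ennreal (\<psi> x) * ennreal (w x) \<partial>Q) \<le> (\<integral>\<^sup>+x. indicator U x * ennreal (w x) \<partial>Q)"
proof -
  interpret finite_measure Q by fact
  have layer: "(\<integral>\<^sup>+x. ennreal (\<psi> x) * indicator {x. r < w x} x \<partial>Q) \<le>
               (\<integral>\<^sup>+x. indicator U x * indicator {x. r < w x} x \<partial>Q)" for r
  proof -
    define A where "A = {x \<in> space Q. x \<notin> U \<and> r < w x}"
    have A: "A \<in> sets Q" unfolding A_def by measurable
    from image_contains_Borel_carrier[OF fin sets_Q S T A]
    obtain C where C [measurable]: "C \<in> sets borel" and CA: "C \<subseteq> T ` A"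
      and AC: "AE x in Q. x \<in> A \<longrightarrow> T x \<in> C" by blast
    \<comment> \<open>A fibre over \<open>C\<close> contains a point outside \<open>U\<close> with
      weight above \<open>r\<close>; by monotonicity every point of \<open>U\<close> on that fibre
      then has weight above \<open>r\<close>.\<close>
    have up: "r < w y" if "y \<in> U" "T y \<in> C" for y
    proof -
      from that CA obtain x where "x \<in> A" "T x = T y" by force
      with mono[of x y] that show ?thesis by (auto simp: A_def)
    qed
    let ?I = "\<lambda>x. indicator {x. r < w x} x :: ennreal"
    \<comment> \<open>Over \<open>C\<close> the layer indicator is simply dropped. Off
      \<open>C\<close> almost every point of the layer lies in \<open>U\<close>, and
      \<open>\<psi>\<close> is at most 1.\<close>
    have "(\<integral>\<^sup>+x. ennreal (\<psi> x) * ?I x \<partial>Q) \<le>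
        (\<integral>\<^sup>+x. ennreal (\<psi> x) * indicator C (T x) + indicator U x * indicator (- C) (T x) * ?I x \<partial>Q)"
    proof (rule nn_integral_mono_AE, use AC AE_space in eventually_elim)
      fix x assume "x \<in> A \<longrightarrow> T x \<in> C" "x \<in> space Q"
      then show "ennreal (\<psi> x) * ?I x \<le>
          ennreal (\<psi> x) * indicator C (T x) + indicator U x * indicator (- C) (T x) * ?I x"
        using \<psi>1[of x] by (auto simp: A_def indicator_def intro: ennreal_leI[of _ 1, simplified])
    qed
    also have "\<dots> = (\<integral>\<^sup>+x. ennreal (\<psi> x) * indicator C (T x) \<partial>Q) +
        (\<integral>\<^sup>+x. indicator U x * indicator (- C) (T x) * ?I x \<partial>Q)"
      by (rule nn_integral_add) measurable
    also have "\<dots> \<le> (\<integral>\<^sup>+x. indicator U x * indicator C (T x) \<partial>Q) +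
        (\<integral>\<^sup>+x. indicator U x * indicator (- C) (T x) * ?I x \<partial>Q)"
      by (intro add_right_mono dom C)
    also have "\<dots> = (\<integral>\<^sup>+x. indicator U x * indicator C (T x) +
        indicator U x * indicator (- C) (T x) * ?I x \<partial>Q)"
      by (rule nn_integral_add[symmetric]) measurable
    \<comment> \<open>Over \<open>C\<close> the set \<open>U\<close> lies inside the layer by
      \<open>up\<close>, so the dropped indicator can be restored.\<close>
    also have "\<dots> = (\<integral>\<^sup>+x. indicator U x * ?I x \<partial>Q)"
      using up by (intro nn_integral_cong) (auto simp: indicator_def)
    finally show ?thesis .
  qed
  have "(\<integral>\<^sup>+x. ennreal (\<psi> x) * ennreal (w x) \<partial>Q) =
      (\<integral>\<^sup>+r. indicator {0..} r * (\<integral>\<^sup>+x. ennreal (\<psi> x) * indicator {x. r < w x} x \<partial>Q) \<partial>lborel)"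
    by (rule nn_integral_layer_cake[OF sigma_finite_measure_axioms w _ w0]) simp
  also have "\<dots> \<le> (\<integral>\<^sup>+r. indicator {0..} r * (\<integral>\<^sup>+x. indicator U x * indicator {x. r < w x} x \<partial>Q) \<partial>lborel)"
    by (rule nn_integral_mono, rule mult_left_mono[OF layer]) simp
  also have "\<dots> = (\<integral>\<^sup>+x. indicator U x * ennreal (w x) \<partial>Q)"
    by (rule nn_integral_layer_cake[OF sigma_finite_measure_axioms w _ w0, symmetric]) simp
  finally show ?thesis .
qed

section \<open>One-sided tests in an exponential family\<close>

lemma borel_measurable_vec:
  fixes g :: "'a \<Rightarrow> real ^ 'n"
  assumes "\<And>i. (\<lambda>x. g x $ i) \<in> borel_measurable M"
  shows "g \<in> borel_measurable M"
  unfolding borel_measurable_euclidean_space[of g]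
  using assms by (auto simp: Basis_vec_def inner_axis)

text \<open>The family is defined for every parameter vector, so all exponential moments of
  \<open>h\<close> are finite under each \<open>P \<theta>\<close>. This supplies the integrability
  for the Laplace transform arguments.\<close>

locale exponential_family_test =
  fixes S :: "('a :: euclidean_space) set"
    and M :: "'a measure"
    and P :: "real ^ ('n :: finite) \<Rightarrow> 'a measure"
    and f :: "real ^ 'n \<Rightarrow> 'a \<Rightarrow> real"
    and h :: "'a \<Rightarrow> real ^ 'n"
    and a :: "real ^ 'n \<Rightarrow> real"
    and b :: "'a \<Rightarrow> real"
    and v :: "real ^ 'n \<Rightarrow> real"
    and i1 :: 'n
    and \<theta>star :: real
  assumes S_borel: "S \<in> sets borel"
    and M_eq: "M = restrict_space lborel S"
    and P_prob: "\<And>\<theta>. prob_space (P \<theta>)"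
    and f_meas: "\<And>\<theta>. f \<theta> \<in> borel_measurable M"
    and P_density: "\<And>\<theta>. P \<theta> = density M (\<lambda>x. ennreal (f \<theta> x))"
    and f_pos: "\<And>\<theta> x. x \<in> S \<Longrightarrow> f \<theta> x > 0"
    and exp_family: "\<And>\<theta> x. x \<in> S \<Longrightarrow> f \<theta> x = b x * exp (\<theta> \<bullet> h x - a \<theta>)"
    and V_statistic [measurable]: "(\<lambda>x. v (h x)) \<in> borel_measurable M"
    and V_increasing: "increasing_in_coord i1 (h ` S) v"
    and TV_indep: "\<And>\<theta>. \<theta> $ i1 = \<theta>star \<Longrightarrow>
          indep_statistics (P \<theta>) (\<Pi>\<^sub>M j\<in>- {i1}. borel) (\<lambda>x. drop_coord i1 (h x))
                                 borel (\<lambda>x. v (h x))"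
begin

section \<open>Likelihood ratios and change of measure\<close>

abbreviation boundary :: "(real ^ 'n) set" where
  "boundary \<equiv> {\<theta>. \<theta> $ i1 = \<theta>star}"

text \<open>Written through \<open>h\<close> instead of as a quotient of densities, so that it is
  positive at every point, also outside \<open>S\<close>.\<close>

definition likelihood_ratio :: "real ^ 'n \<Rightarrow> real ^ 'n \<Rightarrow> 'a \<Rightarrow> real" where
  "likelihood_ratio \<theta>0 \<theta> x = exp ((\<theta> - \<theta>0) \<bullet> h x - (a \<theta> - a \<theta>0))"

lemma space_M [simp]: "space M = S"
  by (simp add: M_eq space_restrict_space)

lemma sets_P [simp, measurable_cong]: "sets (P \<theta>) = sets M"
  by (simp add: P_density)

lemma space_P [simp]: "space (P \<theta>) = S"
  by (simp add: P_density)

lemma prob_S [simp]: "measure (P \<theta>) S = 1"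
  using prob_space.prob_space[OF P_prob[of \<theta>]] by simp

lemma S_sets [simp, measurable]: "S \<in> sets M"
  using sets.top[of M] by simp

lemma Int_S [simp]: "A \<in> sets M \<Longrightarrow> A \<inter> S = A"
  using sets.Int_space_eq2[of A M] by simp

lemma sets_M: "sets M = sets (restrict_space borel S)"
  unfolding M_eq by (rule sets_restrict_space_cong) simp

text \<open>Measurability of \<open>h\<close> is inherited from the densities: the log-likelihood
  ratio between the parameters \<open>axis i 1\<close> and 0 is the \<open>i\<close>-th coordinate
  of \<open>h\<close> up to a constant.\<close>

lemma statistic_measurable [measurable]: "(\<lambda>x. h x $ i) \<in> borel_measurable M"
proof -
  define \<theta> :: "real ^ 'n" where "\<theta> = axis i 1"
  have "h x $ i = ln (f \<theta> x / f 0 x) + (a \<theta> - a 0)" if "x \<in> space M" for x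
  proof -
    have "b x > 0" using f_pos[of x 0] exp_family[of x 0] that
      by (simp add: zero_less_mult_iff)
    then have "f \<theta> x / f 0 x = exp (h x $ i - (a \<theta> - a 0))"
      using that by (simp add: exp_family \<theta>_def inner_axis inner_commute flip: exp_diff)
    then show ?thesis by simp
  qed
  moreover have "(\<lambda>x. ln (f \<theta> x / f 0 x) + (a \<theta> - a 0)) \<in> borel_measurable M"
    using f_meas by measurable
  ultimately show ?thesis by (subst measurable_cong) auto
qed

lemma inner_statistic: "\<eta> \<bullet> h x = (\<Sum>j\<in>UNIV. \<eta> $ j * h x $ j)"
  by (simp add: inner_vec_def)

lemma likelihood_ratio_measurable [measurable]: "likelihood_ratio \<theta>0 \<theta> \<in> borel_measurable M"
  unfolding likelihood_ratio_def inner_statistic by measurable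

lemma likelihood_ratio_pos [simp]: "likelihood_ratio \<theta>0 \<theta> x > 0" "likelihood_ratio \<theta>0 \<theta> x \<ge> 0"
  by (simp_all add: likelihood_ratio_def)

lemma P_eq_density: "P \<theta> = density (P \<theta>0) (\<lambda>x. ennreal (likelihood_ratio \<theta>0 \<theta> x))"
proof -
  have "f \<theta> x = f \<theta>0 x * likelihood_ratio \<theta>0 \<theta> x" if "x \<in> S" for x
    using that by (simp add: exp_family likelihood_ratio_def algebra_simps flip: exp_add)
  moreover have "density (P \<theta>0) (\<lambda>x. ennreal (likelihood_ratio \<theta>0 \<theta> x)) =
      density M (\<lambda>x. ennreal (f \<theta>0 x) * ennreal (likelihood_ratio \<theta>0 \<theta> x))"
    unfolding P_density[of \<theta>0] using f_meas
    by (intro density_density_eq measurable_compose[OF _ measurable_ennreal]) auto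
  ultimately show ?thesis
    unfolding P_density[of \<theta>] using f_meas f_pos
    by (auto intro!: density_cong simp: less_imp_le simp flip: ennreal_mult)
qed

lemma change_of_measure:
  fixes g :: "'a \<Rightarrow> real"
  assumes "g \<in> borel_measurable M"
  shows "integrable (P \<theta>) g \<longleftrightarrow> integrable (P \<theta>0) (\<lambda>x. likelihood_ratio \<theta>0 \<theta> x * g x)"
    and "(\<integral>x. g x \<partial>P \<theta>) = (\<integral>x. likelihood_ratio \<theta>0 \<theta> x * g x \<partial>P \<theta>0)"
  using assms unfolding P_eq_density[of \<theta> \<theta>0]
  by (auto simp: integrable_density integral_density)

section \<open>Completeness and independence on the boundary\<close>

lemma drop_coord_measurable [measurable]:
  "(\<lambda>x. drop_coord i1 (h x)) \<in> M \<rightarrow>\<^sub>M (\<Pi>\<^sub>M j\<in>- {i1}. borel)"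
  unfolding drop_coord_def by measurable

lemma integrable_bounded_test:
  assumes "\<psi> \<in> borel_measurable M" "\<And>x. \<bar>\<psi> x\<bar> \<le> (c :: real)"
  shows "integrable (P \<theta>) \<psi>"
proof -
  interpret prob_space "P \<theta>" by (rule P_prob)
  show ?thesis using assms by (intro integrable_const_bound[of _ c]) auto
qed

text \<open>Moving along the boundary multiplies the density by an arbitrary exponential of the
  remaining coordinates, up to a constant. Zero means on the whole boundary thus say that a Laplace
  transform in these coordinates vanishes.\<close>

lemma boundary_completeness:
  fixes \<psi> :: "'a \<Rightarrow> real"
  assumes \<psi> [measurable]: "\<psi> \<in> borel_measurable M" and bounded: "\<And>x. \<bar>\<psi> x\<bar> \<le> k"
    and zero: "\<And>\<theta>. \<theta> \<in> boundary \<Longrightarrow> (\<integral>x. \<psi> x \<partial>P \<theta>) = 0"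
    and \<theta>0: "\<theta>0 \<in> boundary" and C: "C \<in> sets (\<Pi>\<^sub>M j\<in>- {i1}. borel)"
  shows "(\<integral>x. \<psi> x * indicator C (drop_coord i1 (h x)) \<partial>P \<theta>0) = 0"
  unfolding drop_coord_def
proof (rule integral_exp_zero_imp_vimage_zero[OF _ _ _ _ C])
  fix t :: "'n \<Rightarrow> real"
  \<comment> \<open>The zero entry at \<open>i1\<close> keeps \<open>\<theta>\<close> on the
    boundary and removes the coordinate \<open>h x $ i1\<close> from the exponent.\<close>
  define \<eta> :: "real ^ 'n" where "\<eta> = (\<chi> j. if j = i1 then 0 else t j)"
  define \<theta> where "\<theta> = \<theta>0 + \<eta>"
  have \<theta>: "\<theta> \<in> boundary" using \<theta>0 by (simp add: \<theta>_def \<eta>_def)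
  have "exp (\<Sum>j\<in>-{i1}. t j * h x $ j) = exp (a \<theta> - a \<theta>0) * likelihood_ratio \<theta>0 \<theta> x" for x
  proof -
    have "(\<Sum>j\<in>-{i1}. t j * h x $ j) = (\<Sum>j\<in>-{i1}. \<eta> $ j * h x $ j)"
      by (intro sum.cong) (auto simp: \<eta>_def)
    also have "\<dots> = \<eta> \<bullet> h x"
      unfolding inner_statistic by (intro sum.mono_neutral_left) (auto simp: \<eta>_def)
    finally show ?thesis by (simp add: likelihood_ratio_def \<theta>_def flip: exp_add)
  qed
  then have eq: "(\<lambda>x. \<psi> x * exp (\<Sum>j\<in>-{i1}. t j * h x $ j)) =
      (\<lambda>x. exp (a \<theta> - a \<theta>0) * (likelihood_ratio \<theta>0 \<theta> x * \<psi> x))"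
    by auto
  show "integrable (P \<theta>0) (\<lambda>x. \<psi> x * exp (\<Sum>j\<in>-{i1}. t j * h x $ j))"
    unfolding eq using integrable_bounded_test[OF \<psi> bounded, of \<theta>]
    by (subst (asm) change_of_measure(1)[OF \<psi>, of _ \<theta>0]) simp
  show "(\<integral>x. \<psi> x * exp (\<Sum>j\<in>-{i1}. t j * h x $ j) \<partial>P \<theta>0) = 0"
    unfolding eq using zero[OF \<theta>] by (simp add: change_of_measure(2)[OF \<psi>, of _ \<theta>0])
qed auto

definition V_event :: "real set \<Rightarrow> 'a set" where
  "V_event B = {x \<in> S. v (h x) \<in> B}"

lemma V_event_measurable [measurable]: "B \<in> sets borel \<Longrightarrow> V_event B \<in> sets M"
  using measurable_sets[OF V_statistic] by (auto simp: V_event_def vimage_def Int_def conj_commute)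

lemma V_event_independent:
  assumes "\<theta>0 \<in> boundary" and B: "B \<in> sets borel" and C: "C \<in> sets (\<Pi>\<^sub>M j\<in>- {i1}. borel)"
  shows "measure (P \<theta>0) (V_event B \<inter> ((\<lambda>x. drop_coord i1 (h x)) -` C \<inter> S)) =
         measure (P \<theta>0) (V_event B) * measure (P \<theta>0) ((\<lambda>x. drop_coord i1 (h x)) -` C \<inter> S)"
proof -
  interpret prob_space "P \<theta>0" by (rule P_prob)
  have "V_event B = (\<lambda>x. v (h x)) -` B \<inter> S" by (auto simp: V_event_def)
  then show ?thesis
    using TV_indep[of \<theta>0] assms unfolding indep_statistics_def
    by (subst Int_commute, subst mult.commute) (auto intro!: indep_setD)
qed

text \<open>Between two boundary points the likelihood ratio is a function of the nuisance statistic
  alone, hence independent of \<open>V\<close>. The probability of the event factors out and the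
  remaining integral is the total mass 1.\<close>

lemma prob_V_event_boundary:
  assumes \<theta>0: "\<theta>0 \<in> boundary" and \<theta>1: "\<theta>1 \<in> boundary" and B: "B \<in> sets borel"
  shows "measure (P \<theta>1) (V_event B) = measure (P \<theta>0) (V_event B)"
proof -
  interpret prob_space "P \<theta>0" by (rule P_prob)
  interpret P1: prob_space "P \<theta>1" by (rule P_prob)
  let ?T = "\<lambda>x. drop_coord i1 (h x)" and ?N = "\<Pi>\<^sub>M j\<in>- {i1}. borel :: real measure"
  define U where "U = V_event B"
  have U [measurable]: "U \<in> sets M" using B by (simp add: U_def)
  define W where "W \<omega> = ennreal (exp ((\<Sum>j\<in>-{i1}. (\<theta>1 - \<theta>0) $ j * \<omega> j) - (a \<theta>1 - a \<theta>0)))"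
    for \<omega> :: "'n \<Rightarrow> real"
  have [measurable]: "W \<in> borel_measurable ?N" unfolding W_def by measurable
  have W: "W (?T x) = ennreal (likelihood_ratio \<theta>0 \<theta>1 x)" for x
  proof -
    have "(\<theta>1 - \<theta>0) \<bullet> h x = (\<Sum>j\<in>-{i1}. (\<theta>1 - \<theta>0) $ j * h x $ j)"
      unfolding inner_statistic using \<theta>0 \<theta>1 by (intro sum.mono_neutral_right) auto
    also have "\<dots> = (\<Sum>j\<in>-{i1}. (\<theta>1 - \<theta>0) $ j * ?T x j)"
      by (intro sum.cong) (auto simp: drop_coord_def)
    finally show ?thesis by (simp add: W_def likelihood_ratio_def)
  qed
  \<comment> \<open>Independence as an identity of measures: restricting to \<open>U\<close> only
    scales the law of the nuisance statistic. Integrating \<open>W\<close> against both sides gives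
    the claim.\<close>
  have "distr (density (P \<theta>0) (indicator U)) ?N ?T =
        density (distr (P \<theta>0) ?N ?T) (\<lambda>_. ennreal (prob U))" (is "?D = ?E")
  proof (rule measure_eqI)
    fix C assume "C \<in> sets ?D"
    then have C [measurable]: "C \<in> sets ?N" by simp
    have "emeasure ?D C = emeasure (P \<theta>0) (U \<inter> (?T -` C \<inter> S))"
      using measurable_sets[OF drop_coord_measurable C]
      by (simp add: emeasure_distr emeasure_restricted)
    also have "\<dots> = ennreal (prob U) * emeasure (P \<theta>0) (?T -` C \<inter> S)"
      unfolding emeasure_eq_measure U_def V_event_independent[OF \<theta>0 B C]
      by (simp add: ennreal_mult)
    also have "\<dots> = emeasure ?E C"
      by (simp add: emeasure_density_const emeasure_distr)
    finally show "emeasure ?D C = emeasure ?E C" .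
  qed simp
  then have "(\<integral>\<^sup>+\<omega>. W \<omega> \<partial>?D) = (\<integral>\<^sup>+\<omega>. W \<omega> \<partial>?E)" by simp
  also have "(\<integral>\<^sup>+\<omega>. W \<omega> \<partial>?D) = emeasure (P \<theta>1) U"
    unfolding P_eq_density[of \<theta>1 \<theta>0]
    by (simp add: nn_integral_distr nn_integral_density W emeasure_density mult.commute)
  also have "(\<integral>\<^sup>+\<omega>. W \<omega> \<partial>?E) = ennreal (prob U) * (\<integral>\<^sup>+x. ennreal (likelihood_ratio \<theta>0 \<theta>1 x) \<partial>P \<theta>0)"
    by (simp add: nn_integral_distr nn_integral_density W nn_integral_cmult)
  also have "(\<integral>\<^sup>+x. ennreal (likelihood_ratio \<theta>0 \<theta>1 x) \<partial>P \<theta>0) = emeasure (P \<theta>1) (space (P \<theta>1))"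
    unfolding P_eq_density[of \<theta>1 \<theta>0] by (subst emeasure_density) (auto intro!: nn_integral_cong)
  finally show ?thesis
    by (simp add: P1.emeasure_space_1 P1.emeasure_eq_measure U_def)
qed

text \<open>Given the nuisance statistic, completeness fixes the conditional mean of
  \<open>\<psi>\<close> at \<open>\<gamma>\<close> and independence gives the \<open>V\<close> event
  conditional probability at least \<open>\<gamma>\<close>. The hypothesis \<open>mono\<close> makes
  the event an upper set for the likelihood ratio on each fibre; the sign of
  \<open>\<theta> $ i1 - \<theta>star\<close> lets one statement serve both hypotheses.\<close>

lemma similar_test_le_V_event:
  fixes \<psi> :: "'a \<Rightarrow> real"
  assumes \<psi> [measurable]: "\<psi> \<in> borel_measurable M" and \<psi>01: "\<And>x. 0 \<le> \<psi> x" "\<And>x. \<psi> x \<le> 1"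
    and similar: "\<And>\<theta>. \<theta> \<in> boundary \<Longrightarrow> (\<integral>x. \<psi> x \<partial>P \<theta>) = \<gamma>"
    and B: "B \<in> sets borel"
    and \<gamma>: "\<And>\<theta>. \<theta> \<in> boundary \<Longrightarrow> \<gamma> \<le> measure (P \<theta>) (V_event B)"
    and mono: "\<And>x y. \<lbrakk>x \<in> S; v (h x) \<notin> B; y \<in> S; v (h y) \<in> B; \<And>j. j \<noteq> i1 \<Longrightarrow> h x $ j = h y $ j\<rbrakk>
      \<Longrightarrow> (\<theta> $ i1 - \<theta>star) * h x $ i1 \<le> (\<theta> $ i1 - \<theta>star) * h y $ i1"
  shows "(\<integral>x. \<psi> x \<partial>P \<theta>) \<le> measure (P \<theta>) (V_event B)"
proof -
  define \<theta>0 :: "real ^ 'n" where "\<theta>0 = (\<chi> j. if j = i1 then \<theta>star else \<theta> $ j)"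
  have \<theta>0: "\<theta>0 \<in> boundary" by (simp add: \<theta>0_def)
  interpret Q: prob_space "P \<theta>0" by (rule P_prob)
  interpret P: prob_space "P \<theta>" by (rule P_prob)
  define U where "U = V_event B"
  have U [measurable]: "U \<in> sets M" using B by (simp add: U_def)
  let ?w = "likelihood_ratio \<theta>0 \<theta>"
  \<comment> \<open>The nuisance statistic as a Euclidean vector, the kind of codomain the fibrewise
    lemma requires. The map \<open>E\<close> below translates from the product space in which
    independence is stated.\<close>
  define T :: "'a \<Rightarrow> real ^ 'n" where "T x = (\<chi> j. if j = i1 then 0 else h x $ j)" for x
  have T [measurable]: "T \<in> borel_measurable M"
    unfolding T_def by (rule borel_measurable_vec) simp
  have "(\<integral>\<^sup>+x. ennreal (\<psi> x) * ennreal (?w x) \<partial>P \<theta>0) \<le> (\<integral>\<^sup>+x. indicator U x * ennreal (?w x) \<partial>P \<theta>0)"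
  proof (rule nn_integral_le_if_fibrewise_upper_set[where T = T and S = S])
    fix C :: "(real ^ 'n) set" assume [measurable]: "C \<in> sets borel"
    let ?N = "\<Pi>\<^sub>M j\<in>- {i1}. borel :: real measure"
    define E :: "('n \<Rightarrow> real) \<Rightarrow> real ^ 'n" where "E \<omega> = (\<chi> j. if j = i1 then 0 else \<omega> j)" for \<omega>
    have [measurable]: "E \<in> borel_measurable ?N"
      unfolding E_def
    proof (rule borel_measurable_vec)
      show "(\<lambda>\<omega>. (\<chi> j. if j = i1 then 0 else \<omega> j) $ j) \<in> borel_measurable ?N" for j :: 'n
        by (cases "j = i1") auto
    qed
    define D where "D = E -` C \<inter> space ?N"
    have D [measurable]: "D \<in> sets ?N" unfolding D_def by measurable
    have TD: "T x \<in> C \<longleftrightarrow> drop_coord i1 (h x) \<in> D" for x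
      by (auto simp: D_def E_def T_def drop_coord_def space_PiM vec_eq_iff PiE_iff
          intro!: arg_cong[where f = "\<lambda>u. u \<in> C"] elim!: back_subst[where P = "\<lambda>u. u \<in> C"])
    define R where "R = (\<lambda>x. drop_coord i1 (h x)) -` D \<inter> S"
    have R [measurable]: "R \<in> sets M"
      using measurable_sets[OF drop_coord_measurable D] by (simp add: R_def)
    have TR: "T x \<in> C \<longleftrightarrow> x \<in> R" if "x \<in> S" for x
      using that by (simp add: R_def TD)
    \<comment> \<open>Completeness is applied to \<open>\<psi>\<close> centred at its constant
      boundary mean.\<close>
    have "(\<integral>x. (\<psi> x - \<gamma>) * indicator D (drop_coord i1 (h x)) \<partial>P \<theta>0) = 0"
    proof (rule boundary_completeness[where k = "1 + \<bar>\<gamma>\<bar>"])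
      fix \<theta> assume "\<theta> \<in> boundary"
      interpret prob_space "P \<theta>" by (rule P_prob)
      show "(\<integral>x. \<psi> x - \<gamma> \<partial>P \<theta>) = 0"
        using similar[OF \<open>\<theta> \<in> boundary\<close>] integrable_bounded_test[of \<psi> 1 \<theta>] \<psi>01
        by (subst Bochner_Integration.integral_diff) (auto simp: prob_space)
    next
      show "\<bar>\<psi> x - \<gamma>\<bar> \<le> 1 + \<bar>\<gamma>\<bar>" for x using \<psi>01[of x] by auto
    qed (use \<theta>0 D in auto)
    also have "(\<integral>x. (\<psi> x - \<gamma>) * indicator D (drop_coord i1 (h x)) \<partial>P \<theta>0) =
        (\<integral>x. \<psi> x * indicator R x - \<gamma> * indicator R x \<partial>P \<theta>0)"
      by (intro Bochner_Integration.integral_cong) (auto simp: R_def indicator_def)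
    also have "\<dots> = (\<integral>x. \<psi> x * indicator R x \<partial>P \<theta>0) - (\<integral>x. \<gamma> * indicator R x \<partial>P \<theta>0)"
      using \<psi>01 by (intro Bochner_Integration.integral_diff integrable_bounded_test[where c = "1 + \<bar>\<gamma>\<bar>"])
        (auto simp: indicator_def intro: order_trans[OF \<psi>01(2)])
    finally have "(\<integral>x. \<psi> x * indicator R x \<partial>P \<theta>0) = \<gamma> * measure (P \<theta>0) R"
      by simp
    also have "\<dots> \<le> measure (P \<theta>0) U * measure (P \<theta>0) R"
      unfolding U_def by (intro mult_right_mono \<gamma> \<theta>0) simp
    also have "\<dots> = measure (P \<theta>0) (U \<inter> R)"
      unfolding U_def R_def by (rule V_event_independent[OF \<theta>0 B D, symmetric])
    finally have le: "(\<integral>x. \<psi> x * indicator R x \<partial>P \<theta>0) \<le> measure (P \<theta>0) (U \<inter> R)" .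
    have "(\<integral>\<^sup>+x. ennreal (\<psi> x) * indicator C (T x) \<partial>P \<theta>0) = (\<integral>\<^sup>+x. ennreal (\<psi> x * indicator R x) \<partial>P \<theta>0)"
      by (intro nn_integral_cong) (auto simp: TR indicator_def)
    also have "\<dots> = ennreal (\<integral>x. \<psi> x * indicator R x \<partial>P \<theta>0)"
      using \<psi>01 by (intro nn_integral_eq_integral integrable_bounded_test[where c = 1])
        (auto simp: indicator_def)
    also have "\<dots> \<le> emeasure (P \<theta>0) (U \<inter> R)"
      unfolding Q.emeasure_eq_measure by (rule ennreal_leI[OF le])
    also have "\<dots> = (\<integral>\<^sup>+x. indicator U x * indicator C (T x) \<partial>P \<theta>0)"
    proof -
      have "emeasure (P \<theta>0) (U \<inter> R) = (\<integral>\<^sup>+x. indicator (U \<inter> R) x \<partial>P \<theta>0)"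
        by (rule nn_integral_indicator[symmetric]) simp
      also have "\<dots> = (\<integral>\<^sup>+x. indicator U x * indicator C (T x) \<partial>P \<theta>0)"
        by (intro nn_integral_cong) (auto simp: TR indicator_def)
      finally show ?thesis .
    qed
    finally show "(\<integral>\<^sup>+x. ennreal (\<psi> x) * indicator C (T x) \<partial>P \<theta>0) \<le>
      (\<integral>\<^sup>+x. indicator U x * indicator C (T x) \<partial>P \<theta>0)" .
  next
    fix x y assume xy: "x \<in> space (P \<theta>0) - U" "y \<in> U" "T x = T y"
    have same: "h x $ j = h y $ j" if "j \<noteq> i1" for j
    proof -
      have "T x $ j = T y $ j" using xy(3) by simp
      then show ?thesis using that by (simp add: T_def)
    qed
    \<comment> \<open>\<open>\<theta>\<close> differs from its projection only at \<open>i1\<close>,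
      so the likelihood ratio depends on this coordinate of \<open>h\<close> alone.\<close>
    have "(\<theta> - \<theta>0) \<bullet> h z = (\<theta> $ i1 - \<theta>star) * h z $ i1" for z
    proof -
      have "(\<theta> - \<theta>0) \<bullet> h z = (\<Sum>j\<in>{i1}. (\<theta> - \<theta>0) $ j * h z $ j)"
        unfolding inner_statistic by (intro sum.mono_neutral_right) (auto simp: \<theta>0_def)
      then show ?thesis by (simp add: \<theta>0_def)
    qed
    then show "?w x \<le> ?w y"
      using mono[of x y] same xy by (simp add: likelihood_ratio_def U_def V_event_def)
  qed (use \<psi>01 S_borel sets_M Q.finite_measure_axioms in auto)
  also have "(\<integral>\<^sup>+x. ennreal (\<psi> x) * ennreal (?w x) \<partial>P \<theta>0) = (\<integral>\<^sup>+x. ennreal (\<psi> x) \<partial>P \<theta>)"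
    unfolding P_eq_density[of \<theta> \<theta>0] by (simp add: nn_integral_density mult.commute)
  also have "\<dots> = ennreal (\<integral>x. \<psi> x \<partial>P \<theta>)"
    using \<psi>01 by (intro nn_integral_eq_integral integrable_bounded_test[where c = 1]) auto
  also have "(\<integral>\<^sup>+x. indicator U x * ennreal (?w x) \<partial>P \<theta>0) = emeasure (P \<theta>) U"
    unfolding P_eq_density[of \<theta> \<theta>0] by (simp add: emeasure_density mult.commute)
  finally show ?thesis
    by (simp add: P.emeasure_eq_measure U_def)
qed

section \<open>Continuity of power functions and similarity of unbiased tests\<close>

text \<open>Dominated convergence along parameters that approach \<open>\<theta>0\<close> from above
  in direction \<open>i1\<close>, the side on which the alternative lies when
  \<open>\<theta>0\<close> is a boundary point.\<close>

lemma prob_continuous_at_boundary: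
  assumes A [measurable]: "A \<in> sets M"
  shows "(\<lambda>n. measure (P (\<theta>0 + axis i1 (1 / real (Suc n)))) A) \<longlonglongrightarrow> measure (P \<theta>0) A"
proof -
  interpret Q: prob_space "P \<theta>0" by (rule P_prob)
  define \<theta> where "\<theta> r = \<theta>0 + axis i1 r" for r
  define K where "K A r = (\<integral>x. indicator A x * exp (r * h x $ i1) \<partial>P \<theta>0)" for A r
  have lr: "likelihood_ratio \<theta>0 (\<theta> r) x = exp (r * h x $ i1) / exp (a (\<theta> r) - a \<theta>0)" for r x
    by (simp add: likelihood_ratio_def \<theta>_def inner_axis' flip: exp_diff)
  \<comment> \<open>\<open>P (\<theta> 1)\<close> has finite mass, which says exactly that this
    exponential moment is finite under \<open>P \<theta>0\<close>. It dominates, since exponents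
    scaled by a factor in (0,1] give at most 1 or the full exponential.\<close>
  have intexp: "integrable (P \<theta>0) (\<lambda>x. exp (h x $ i1))"
  proof -
    have "integrable (P (\<theta> 1)) (\<lambda>x. 1 :: real)"
      by (rule integrable_bounded_test[where c = 1]) auto
    then have "integrable (P \<theta>0) (\<lambda>x. likelihood_ratio \<theta>0 (\<theta> 1) x * 1)"
      by (subst (asm) change_of_measure(1)[of _ _ \<theta>0]) auto
    then have "integrable (P \<theta>0) (\<lambda>x. exp (a (\<theta> 1) - a \<theta>0) * (likelihood_ratio \<theta>0 (\<theta> 1) x * 1))"
      by (rule integrable_mult_right)
    then show ?thesis by (simp add: lr)
  qed
  have K: "(\<lambda>n. K A (1 / real (Suc n))) \<longlonglongrightarrow> measure (P \<theta>0) A" if [measurable]: "A \<in> sets M" for A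
  proof -
    have "(\<lambda>n. K A (1 / real (Suc n))) \<longlonglongrightarrow> (\<integral>x. indicator A x \<partial>P \<theta>0)"
      unfolding K_def
    proof (rule integral_dominated_convergence[where w = "\<lambda>x. 1 + exp (h x $ i1)"])
      show "integrable (P \<theta>0) (\<lambda>x. 1 + exp (h x $ i1))" using intexp by simp
      show "AE x in P \<theta>0. (\<lambda>n. indicator A x * exp (1 / real (Suc n) * h x $ i1)) \<longlonglongrightarrow> indicator A x"
      proof (rule AE_I2)
        fix x
        have "(\<lambda>n. indicator A x * exp (1 / real (Suc n) * h x $ i1)) \<longlonglongrightarrow>
            indicator A x * exp (0 * h x $ i1)"
          by (intro tendsto_intros LIMSEQ_Suc[OF lim_1_over_n])
        then show "(\<lambda>n. indicator A x * exp (1 / real (Suc n) * h x $ i1)) \<longlonglongrightarrow> indicator A x"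
          by simp
      qed
      show "AE x in P \<theta>0. norm (indicator A x * exp (1 / real (Suc n) * h x $ i1)) \<le> 1 + exp (h x $ i1)" for n
      proof (rule AE_I2)
        fix x
        have "exp (1 / real (Suc n) * h x $ i1) \<le> 1 + exp (h x $ i1)"
        proof (cases "h x $ i1 \<ge> 0")
          case True
          then have "1 / real (Suc n) * h x $ i1 \<le> h x $ i1"
            by (intro mult_left_le_one_le) auto
          then have "exp (1 / real (Suc n) * h x $ i1) \<le> exp (h x $ i1)"
            by (simp only: exp_le_cancel_iff)
          then show ?thesis by linarith
        next
          case False
          then have "exp (1 / real (Suc n) * h x $ i1) \<le> 1"
            by (simp add: divide_le_0_iff)
          then show ?thesis using exp_ge_zero[of "h x $ i1"] by linarith
        qed
        then show "norm (indicator A x * exp (1 / real (Suc n) * h x $ i1)) \<le> 1 + exp (h x $ i1)"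
          by (simp add: indicator_def add_nonneg_nonneg)
      qed
    qed auto
    then show ?thesis by simp
  qed
  have eq: "measure (P (\<theta> r)) A = K A r / exp (a (\<theta> r) - a \<theta>0)" if [measurable]: "A \<in> sets M" for A r
  proof -
    have "measure (P (\<theta> r)) A = (\<integral>x. indicator A x \<partial>P (\<theta> r))" by simp
    also have "\<dots> = (\<integral>x. likelihood_ratio \<theta>0 (\<theta> r) x * indicator A x \<partial>P \<theta>0)"
      by (rule change_of_measure(2)) simp
    also have "\<dots> = (\<integral>x. indicator A x * exp (r * h x $ i1) / exp (a (\<theta> r) - a \<theta>0) \<partial>P \<theta>0)"
      by (simp add: lr mult.commute)
    finally show ?thesis by (simp add: K_def)
  qed
  \<comment> \<open>Dividing by the case \<open>A = S\<close> cancels the normaliser, so the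
    continuity of \<open>a\<close> never enters.\<close>
  have "measure (P (\<theta> r)) A = K A r / K S r" for r
    using eq[of A r] eq[of S r] prob_S[of "\<theta> r"] by simp
  moreover have "(\<lambda>n. K A (1 / real (Suc n)) / K S (1 / real (Suc n))) \<longlonglongrightarrow> measure (P \<theta>0) A / measure (P \<theta>0) S"
    by (intro tendsto_divide K A) auto
  ultimately show ?thesis by (simp add: \<theta>_def)
qed

definition null_hyp :: "(real ^ 'n) set" where
  "null_hyp = {\<theta>. \<theta> $ i1 \<le> \<theta>star}"

lemma boundary_subset_null: "boundary \<subseteq> null_hyp"
  by (auto simp: null_hyp_def)

lemma perturbed_boundary_alternative:
  "\<theta>0 \<in> boundary \<Longrightarrow> \<theta>0 + axis i1 (1 / real (Suc n)) \<in> UNIV - null_hyp"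
  by (simp add: null_hyp_def)

lemma prob_P_le_1: "measure (P \<theta>) A \<le> 1"
  using prob_space.prob_le_1[OF P_prob] .

lemma bdd_above_prob: "bdd_above ((\<lambda>\<theta>. prob_decide (P \<theta>) \<psi> d) ` \<Theta>)"
  by (rule bdd_aboveI[of _ 1]) (auto simp: prob_decide_def prob_P_le_1)

lemma bdd_below_prob: "bdd_below ((\<lambda>\<theta>. prob_decide (P \<theta>) \<psi> d) ` \<Theta>)"
  by (rule bdd_belowI[of _ 0]) (auto simp: prob_decide_def)

lemma prob_decide_le_type1_error:
  "\<theta> \<in> H \<Longrightarrow> prob_decide (P \<theta>) \<psi> 1 \<le> type1_error P H \<psi>"
  unfolding type1_error_def by (rule cSUP_upper[OF _ bdd_above_prob])

lemma prob_decide_le_type2_error: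
  "\<theta> \<in> \<Theta> - H \<Longrightarrow> prob_decide (P \<theta>) \<psi> 0 \<le> type2_error P \<Theta> H \<psi>"
  unfolding type2_error_def by (rule cSUP_upper[OF _ bdd_above_prob])

lemma agnostic_test_events:
  assumes "agnostic_test M \<psi>" "d \<in> {0, 1/2, 1}"
  shows "{x \<in> S. \<psi> x = d} \<in> sets M"
proof -
  have "\<psi> -` {d} \<inter> space M \<in> sets M"
    using assms unfolding agnostic_test_def by (intro measurable_sets) auto
  then show ?thesis by (simp add: vimage_def Int_def conj_commute)
qed

lemma prob_decide_eq: "prob_decide (P \<theta>) \<psi> d = measure (P \<theta>) {x \<in> S. \<psi> x = d}"
  by (simp add: prob_decide_def)

text \<open>The boundary lies in the null hypothesis and in the closure of the alternative, so both
  the supremum bounds and the unbiasedness bounds apply there.\<close>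

lemma unbiased_test_similar:
  assumes test: "agnostic_test M \<psi>" and unbiased: "unbiased_test P UNIV null_hyp \<psi>"
    and \<theta>: "\<theta> \<in> boundary"
  shows "prob_decide (P \<theta>) \<psi> 1 = type1_error P null_hyp \<psi>"
    and "prob_decide (P \<theta>) \<psi> 0 = type2_error P UNIV null_hyp \<psi>"
proof -
  let ?\<theta> = "\<lambda>n. \<theta> + axis i1 (1 / real (Suc n))"
  have lim: "(\<lambda>n. prob_decide (P (?\<theta> n)) \<psi> d) \<longlonglongrightarrow> prob_decide (P \<theta>) \<psi> d"
    if "d \<in> {0, 1/2, 1}" for d
    unfolding prob_decide_eq
    by (rule prob_continuous_at_boundary[OF agnostic_test_events[OF test that]])
  note alt = perturbed_boundary_alternative[OF \<theta>]
  have null: "\<theta> \<in> null_hyp" using \<theta> boundary_subset_null by blast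
  show "prob_decide (P \<theta>) \<psi> 1 = type1_error P null_hyp \<psi>"
  proof (rule antisym)
    show "prob_decide (P \<theta>) \<psi> 1 \<le> type1_error P null_hyp \<psi>"
      by (rule prob_decide_le_type1_error[OF null])
    have "type1_error P null_hyp \<psi> \<le> prob_decide (P (?\<theta> n)) \<psi> 1" for n
      using unbiased cINF_lower[OF bdd_below_prob alt, of \<psi> 1 n]
      unfolding unbiased_test_def by linarith
    then show "type1_error P null_hyp \<psi> \<le> prob_decide (P \<theta>) \<psi> 1"
      by (intro LIMSEQ_le_const[OF lim[of 1]]) auto
  qed
  show "prob_decide (P \<theta>) \<psi> 0 = type2_error P UNIV null_hyp \<psi>"
  proof (rule antisym)
    have "prob_decide (P (?\<theta> n)) \<psi> 0 \<le> type2_error P UNIV null_hyp \<psi>" for n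
      by (rule prob_decide_le_type2_error[OF alt])
    then show "prob_decide (P \<theta>) \<psi> 0 \<le> type2_error P UNIV null_hyp \<psi>"
      by (intro LIMSEQ_le_const2[OF lim[of 0]]) auto
    show "type2_error P UNIV null_hyp \<psi> \<le> prob_decide (P \<theta>) \<psi> 0"
      using unbiased cINF_lower[OF bdd_below_prob null, of \<psi> 0]
      unfolding unbiased_test_def by linarith
  qed
qed

section \<open>Optimality and size of the one-sided \<open>V\<close> events\<close>

text \<open>Contrapositive of monotonicity. Strict inequality of \<open>V\<close> values is
  essential, because \<open>V\<close> may be constant along parts of a fibre.\<close>

lemma statistic_le_if_V_less:
  assumes "x \<in> S" "y \<in> S" "v (h x) < v (h y)" "\<And>j. j \<noteq> i1 \<Longrightarrow> h x $ j = h y $ j"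
  shows "h x $ i1 \<le> h y $ i1"
proof (rule ccontr)
  assume "\<not> h x $ i1 \<le> h y $ i1"
  then have "v (h y) \<le> v (h x)"
    using V_increasing assms unfolding increasing_in_coord_def by force
  with assms(3) show False by simp
qed

text \<open>Under the null hypothesis the likelihood ratio relative to the boundary is nonincreasing
  in the first statistic, so on each fibre it is largest where \<open>V\<close> is small.\<close>

lemma similar_test_le_V_lower:
  fixes \<psi> :: "'a \<Rightarrow> real"
  assumes "\<psi> \<in> borel_measurable M" "\<And>x. 0 \<le> \<psi> x" "\<And>x. \<psi> x \<le> 1"
    and "\<And>\<theta>. \<theta> \<in> boundary \<Longrightarrow> (\<integral>x. \<psi> x \<partial>P \<theta>) = \<gamma>"
    and "\<And>\<theta>. \<theta> \<in> boundary \<Longrightarrow> \<gamma> \<le> measure (P \<theta>) (V_event {..c})"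
    and "\<theta> \<in> null_hyp"
  shows "(\<integral>x. \<psi> x \<partial>P \<theta>) \<le> measure (P \<theta>) (V_event {..c})"
proof (rule similar_test_le_V_event[OF assms(1-4)])
  fix x y assume "x \<in> S" "v (h x) \<notin> {..c}" "y \<in> S" "v (h y) \<in> {..c}" "\<And>j. j \<noteq> i1 \<Longrightarrow> h x $ j = h y $ j"
  then have "h y $ i1 \<le> h x $ i1" by (intro statistic_le_if_V_less) auto
  then show "(\<theta> $ i1 - \<theta>star) * h x $ i1 \<le> (\<theta> $ i1 - \<theta>star) * h y $ i1"
    using assms(6) by (intro mult_left_mono_neg) (auto simp: null_hyp_def)
qed (use assms(5) in auto)

text \<open>Under the alternative the factor \<open>\<theta> $ i1 - \<theta>star\<close> is
  positive, so large values of \<open>V\<close> are favoured.\<close>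

lemma similar_test_le_V_upper:
  fixes \<psi> :: "'a \<Rightarrow> real"
  assumes "\<psi> \<in> borel_measurable M" "\<And>x. 0 \<le> \<psi> x" "\<And>x. \<psi> x \<le> 1"
    and "\<And>\<theta>. \<theta> \<in> boundary \<Longrightarrow> (\<integral>x. \<psi> x \<partial>P \<theta>) = \<gamma>"
    and "\<And>\<theta>. \<theta> \<in> boundary \<Longrightarrow> \<gamma> \<le> measure (P \<theta>) (V_event {c<..})"
    and "\<theta> \<notin> null_hyp"
  shows "(\<integral>x. \<psi> x \<partial>P \<theta>) \<le> measure (P \<theta>) (V_event {c<..})"
proof (rule similar_test_le_V_event[OF assms(1-4)])
  fix x y assume "x \<in> S" "v (h x) \<notin> {c<..}" "y \<in> S" "v (h y) \<in> {c<..}" "\<And>j. j \<noteq> i1 \<Longrightarrow> h x $ j = h y $ j"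
  then have "h x $ i1 \<le> h y $ i1" by (intro statistic_le_if_V_less) auto
  then show "(\<theta> $ i1 - \<theta>star) * h x $ i1 \<le> (\<theta> $ i1 - \<theta>star) * h y $ i1"
    using assms(6) by (intro mult_left_mono) (auto simp: null_hyp_def)
qed (use assms(5) in auto)

lemma prob_V_upper: "measure (P \<theta>) (V_event {c<..}) = 1 - measure (P \<theta>) (V_event {..c})"
proof -
  interpret prob_space "P \<theta>" by (rule P_prob)
  have "V_event {c<..} = space (P \<theta>) - V_event {..c}" by (auto simp: V_event_def)
  then show ?thesis using prob_compl[of "V_event {..c}"] by simp
qed

text \<open>Optimality of the complementary lower event under the null hypothesis, read through
  complements.\<close>

lemma V_upper_size:
  assumes "\<theta>0 \<in> boundary" "\<theta> \<in> null_hyp"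
  shows "measure (P \<theta>) (V_event {c<..}) \<le> measure (P \<theta>0) (V_event {c<..})"
proof -
  \<comment> \<open>the competitor is the randomised test that ignores the data\<close>
  have "(\<integral>x. measure (P \<theta>0) (V_event {..c}) \<partial>P \<theta>) \<le> measure (P \<theta>) (V_event {..c})"
  proof (rule similar_test_le_V_lower[OF _ _ _ _ _ assms(2)])
    show "measure (P \<theta>0) (V_event {..c}) \<le> measure (P \<theta>') (V_event {..c})" if "\<theta>' \<in> boundary" for \<theta>'
      by (rule eq_refl[OF prob_V_event_boundary[OF that assms(1)]]) simp
  qed (simp_all add: prob_P_le_1)
  then show ?thesis by (simp add: prob_V_upper)
qed

text \<open>Mirror image of \<open>V_upper_size\<close>: under the alternative the upper event is
  compared with a constant test.\<close>

lemma V_lower_size: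
  assumes "\<theta>0 \<in> boundary" "\<theta> \<notin> null_hyp"
  shows "measure (P \<theta>) (V_event {..c}) \<le> measure (P \<theta>0) (V_event {..c})"
proof -
  have "(\<integral>x. measure (P \<theta>0) (V_event {c<..}) \<partial>P \<theta>) \<le> measure (P \<theta>) (V_event {c<..})"
  proof (rule similar_test_le_V_upper[OF _ _ _ _ _ assms(2)])
    show "measure (P \<theta>0) (V_event {c<..}) \<le> measure (P \<theta>') (V_event {c<..})" if "\<theta>' \<in> boundary" for \<theta>'
      by (rule eq_refl[OF prob_V_event_boundary[OF that assms(1)]]) simp
  qed (simp_all add: prob_P_le_1)
  then show ?thesis by (simp add: prob_V_upper)
qed

section \<open>Level and optimality of the threshold test\<close>

lemma threshold_test_UMPU:
  assumes \<theta>bar: "\<theta>bar \<in> boundary"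
    and \<alpha>\<beta>: "\<alpha> + \<beta> \<le> 1"
    and c0: "measure (P \<theta>bar) (V_event {..c0}) = \<beta>"
    and c1: "measure (P \<theta>bar) (V_event {c1<..}) = \<alpha>"
  shows "UMPU_level_test M P UNIV null_hyp \<alpha> \<beta> (threshold_test (\<lambda>x. v (h x)) c0 c1)"
proof -
  let ?\<phi> = "threshold_test (\<lambda>x. v (h x)) c0 c1"
  \<comment> \<open>\<open>c0 \<le> c1\<close> is not assumed, and acceptance takes precedence over rejection\<close>
  define c where "c = max c0 c1"
  have accept: "{x \<in> S. ?\<phi> x = 0} = V_event {..c0}"
    and reject: "{x \<in> S. ?\<phi> x = 1} = V_event {c<..}"
    by (auto simp: threshold_test_def V_event_def c_def)
  have agnostic: "{x \<in> S. ?\<phi> x = 1/2} = V_event {c0<..c1}"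
    by (auto simp: threshold_test_def V_event_def)
  have test: "agnostic_test M ?\<phi>"
    unfolding agnostic_test_def
  proof (subst measurable_count_space_eq2, simp, intro conjI ballI)
    fix d :: real assume "d \<in> {0, 1/2, 1}"
    then consider "d = 0" | "d = 1" | "d = 1/2" by blast
    then have "{x \<in> S. ?\<phi> x = d} \<in> sets M"
      by cases (simp_all only: accept reject agnostic V_event_measurable atMost_borel greaterThan_borel greaterThanAtMost_borel)
    then show "?\<phi> -` {d} \<inter> space M \<in> sets M" by (simp add: vimage_def Int_def conj_commute)
  qed (auto simp: threshold_test_def)
  \<comment> \<open>If \<open>c1 < c0\<close>, then 1 - \<beta> is the probability of
    \<open>V > c0\<close> and hence at most \<alpha>, while
    \<open>\<alpha> + \<beta> \<le> 1\<close> gives the reverse bound. Raising the rejection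
    threshold to \<open>c\<close> therefore preserves the probability \<alpha>.\<close>
  have rejectbar: "measure (P \<theta>bar) (V_event {c<..}) = \<alpha>"
  proof (cases "c0 \<le> c1")
    case False
    interpret prob_space "P \<theta>bar" by (rule P_prob)
    have "prob (V_event {c<..}) \<le> prob (V_event {c1<..})"
      by (intro finite_measure_mono) (auto simp: V_event_def c_def)
    moreover have "c = c0" using False by (simp add: c_def)
    ultimately show ?thesis using c0 c1 \<alpha>\<beta> by (simp add: prob_V_upper)
  qed (use c1 in \<open>simp add: c_def\<close>)
  have null: "\<theta>bar \<in> null_hyp" using \<theta>bar boundary_subset_null by blast
  have type1: "type1_error P null_hyp ?\<phi> = \<alpha>"
  proof (rule antisym)
    show "type1_error P null_hyp ?\<phi> \<le> \<alpha>"
      unfolding type1_error_def prob_decide_eq reject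
      using null V_upper_size[OF \<theta>bar] rejectbar by (intro cSUP_least) auto
    show "\<alpha> \<le> type1_error P null_hyp ?\<phi>"
      using prob_decide_le_type1_error[OF null, of ?\<phi>] by (simp add: prob_decide_eq reject rejectbar)
  qed
  \<comment> \<open>The parameter \<open>\<theta>bar\<close> lies outside the alternative, so
    \<beta> is reached as a limit along perturbed parameters. For the type I error the supremum is
    attained at \<open>\<theta>bar\<close> itself.\<close>
  have type2: "type2_error P UNIV null_hyp ?\<phi> = \<beta>"
  proof (rule antisym)
    note alt = perturbed_boundary_alternative[OF \<theta>bar]
    show "type2_error P UNIV null_hyp ?\<phi> \<le> \<beta>"
      unfolding type2_error_def prob_decide_eq accept
      using alt V_lower_size[OF \<theta>bar, of _ c0] c0 by (intro cSUP_least) auto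
    have "V_event {..c0} \<in> sets M" by simp
    from prob_continuous_at_boundary[OF this, of \<theta>bar]
    show "\<beta> \<le> type2_error P UNIV null_hyp ?\<phi>"
      unfolding c0
      using prob_decide_le_type2_error[OF alt, where \<psi> = ?\<phi>]
      by (intro LIMSEQ_le_const2) (auto simp: prob_decide_eq accept)
  qed
  have powerful: "at_least_as_powerful P UNIV null_hyp ?\<phi> \<psi>"
    if \<psi>: "agnostic_test M \<psi>" "unbiased_test P UNIV null_hyp \<psi>" and size: "has_size P UNIV null_hyp \<alpha> \<beta> \<psi>" for \<psi>
    unfolding at_least_as_powerful_def
  proof
    fix \<theta>
    have ev [measurable]: "{x \<in> S. \<psi> x = 0} \<in> sets M" "{x \<in> S. \<psi> x = 1} \<in> sets M"
      using agnostic_test_events[OF \<psi>(1)] by auto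
    have int: "(\<integral>x. indicator {x \<in> S. \<psi> x = d} x \<partial>P \<theta>) = prob_decide (P \<theta>) \<psi> d"
      if "d \<in> {0, 1}" for \<theta> d
      using that ev by (auto simp: prob_decide_eq)
    show "power_fun P null_hyp \<psi> \<theta> \<le> power_fun P null_hyp ?\<phi> \<theta>"
    proof (cases "\<theta> \<in> null_hyp")
      case True
      have "(\<integral>x. indicator {x \<in> S. \<psi> x = 0} x \<partial>P \<theta>) \<le> measure (P \<theta>) (V_event {..c0})"
      proof (rule similar_test_le_V_lower[OF _ _ _ _ _ True])
        \<comment> \<open>By similarity the acceptance probability of \<open>\<psi>\<close> on the
          boundary is its own type II error, which its size bounds by \<beta>, the boundary
          probability of the lower \<open>V\<close> event.\<close>
        show "(\<integral>x. indicator {x \<in> S. \<psi> x = 0} x \<partial>P \<theta>) = type2_error P UNIV null_hyp \<psi>"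
          if "\<theta> \<in> boundary" for \<theta>
          using unbiased_test_similar(2)[OF \<psi> that] int[of 0 \<theta>] by simp
        show "type2_error P UNIV null_hyp \<psi> \<le> measure (P \<theta>) (V_event {..c0})"
          if "\<theta> \<in> boundary" for \<theta>
          using size prob_V_event_boundary[OF \<theta>bar that, of "{..c0}"] c0 by (simp add: has_size_def)
      qed (use ev in auto)
      then show ?thesis using True int[of 0 \<theta>] by (simp add: power_fun_def prob_decide_eq accept)
    next
      case False
      have "(\<integral>x. indicator {x \<in> S. \<psi> x = 1} x \<partial>P \<theta>) \<le> measure (P \<theta>) (V_event {c<..})"
      proof (rule similar_test_le_V_upper[OF _ _ _ _ _ False])
        show "(\<integral>x. indicator {x \<in> S. \<psi> x = 1} x \<partial>P \<theta>) = type1_error P null_hyp \<psi>"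
          if "\<theta> \<in> boundary" for \<theta>
          using unbiased_test_similar(1)[OF \<psi> that] int[of 1 \<theta>] by simp
        show "type1_error P null_hyp \<psi> \<le> measure (P \<theta>) (V_event {c<..})"
          if "\<theta> \<in> boundary" for \<theta>
          using size prob_V_event_boundary[OF \<theta>bar that, of "{c<..}"] rejectbar by (simp add: has_size_def)
      qed (use ev in auto)
      then show ?thesis using False int[of 1 \<theta>] by (simp add: power_fun_def prob_decide_eq reject)
    qed
  qed
  show ?thesis
    unfolding UMPU_level_test_def has_level_def using test type1 type2 powerful by blast
qed

end

theorem mainTheorem2:
  fixes S :: "('a :: euclidean_space) set"
    and M :: "'a measure"
    and P :: "real ^ ('n :: finite) \<Rightarrow> 'a measure"
    and f :: "real ^ 'n \<Rightarrow> 'a \<Rightarrow> real"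
    and h :: "'a \<Rightarrow> real ^ 'n"
    and a :: "real ^ 'n \<Rightarrow> real"
    and b :: "'a \<Rightarrow> real"
    and v :: "real ^ 'n \<Rightarrow> real"
    and i1 :: 'n
    and \<theta>star :: real
    and H0 :: "(real ^ 'n) set"
    and \<theta>bar :: "real ^ 'n"
    and \<alpha> \<beta> c0 c1 :: real
  assumes S_borel: "S \<in> sets borel"
    and M_eq: "M = restrict_space lborel S"
    and P_prob: "\<And>\<theta>. prob_space (P \<theta>)"
    and H0_eq: "H0 = {\<theta>. \<theta> $ i1 \<le> \<theta>star}"
    and P_ac: "\<And>\<theta>. absolutely_continuous M (P \<theta>)"
    and f_meas: "\<And>\<theta>. f \<theta> \<in> borel_measurable M"
    and P_density: "\<And>\<theta>. P \<theta> = density M (\<lambda>x. ennreal (f \<theta> x))"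
    and f_pos: "\<And>\<theta> x. x \<in> S \<Longrightarrow> f \<theta> x > 0"
    and exp_family: "\<And>\<theta> x. x \<in> S \<Longrightarrow> f \<theta> x = b x * exp (\<theta> \<bullet> h x - a \<theta>)"
    and V_statistic: "(\<lambda>x. v (h x)) \<in> borel_measurable M"
    and V_increasing: "increasing_in_coord i1 (h ` S) v"
    and TV_indep: "\<And>\<theta>. \<theta> $ i1 = \<theta>star \<Longrightarrow>
          indep_statistics (P \<theta>) (\<Pi>\<^sub>M j\<in>- {i1}. borel) (\<lambda>x. drop_coord i1 (h x))
                                 borel (\<lambda>x. v (h x))"
    and \<theta>bar: "\<theta>bar $ i1 = \<theta>star"
    and \<alpha>_range: "0 \<le> \<alpha>" "\<alpha> \<le> 1"
    and \<beta>_range: "0 \<le> \<beta>" "\<beta> \<le> 1"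
    and \<alpha>\<beta>: "\<alpha> + \<beta> \<le> 1"
    and c0: "measure (P \<theta>bar) {x \<in> space (P \<theta>bar). v (h x) \<le> c0} = \<beta>"
    and c1: "measure (P \<theta>bar) {x \<in> space (P \<theta>bar). v (h x) > c1} = \<alpha>"
  shows "UMPU_level_test M P UNIV H0 \<alpha> \<beta> (threshold_test (\<lambda>x. v (h x)) c0 c1)"
proof -
  interpret exponential_family_test S M P f h a b v i1 \<theta>star
    by (rule exponential_family_test.intro) (fact assms)+
  have "H0 = null_hyp" by (simp add: H0_eq null_hyp_def)
  with threshold_test_UMPU[of \<theta>bar \<alpha> \<beta> c0 c1] \<theta>bar \<alpha>\<beta> c0 c1 show ?thesis
    by (simp add: V_event_def)
qed

end
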